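(* Let $\mathcal{P}$ be a finite chiral $n$-polytope, and let $\mathcal{Q}$ be a finite directly regular $n$-polytope whose rotation group $\Gamma^+(\mathcal{Q})$ is simple. If $X(\mathcal{P})$ is not isomorphic to $\Gamma^+(\mathcal{Q})$, then $X(\mathcal{P}\diamond\mathcal{Q})=X(\mathcal{P})$ (in particular $X(\mathcal{P}\diamond\mathcal{Q})\cong X(\mathcal{P})$).
   Context: All polytopes are abstract polytopes. A regular polytope is directly regular if its rotation group $\Gamma^+(\mathcal{P})$, generated by $\sigma_i=\rho_{i-1}\rho_i$ ($\rho_0,\dots,\rho_{n-1}$ the standard generating involutions relative to a base flag), has index $2$ in the automorphism group. A polytope is chiral if its automorphism group has two orbits on flags, adjacent flags lying in distinct orbits; then $\Gamma^+(\mathcal{P})$ is the full automorphism group, generated by standard rotations $\sigma_1,\dots,\sigma_{n-1}$. Let $W^+=\langle \sigma_1,\dots,\sigma_{n-1}\mid (\sigma_i\cdots\sigma_j)^2=1,\ 1\le i<j\le n-1\rangle$; each such $\Gamma^+(\mathcal{P})$ equals $W^+/M$ for a normal subgroup $M$, generators corresponding. Let $w\mapsto\overline{w}$ be the automorphism of $W^+$ with $\sigma_1\mapsto\sigma_1^{-1}$, $\sigma_2\mapsto\sigma_1^2\sigma_2$, $\sigma_j\mapsto\sigma_j$ ($j\ge3$). Mix: if $\Gamma^+(\mathcal{P})=W^+/M$ and $\Gamma^+(\mathcal{Q})=W^+/K$, the mix $\mathcal{P}\diamond\mathcal{Q}$ is the (flag-connected pre-)polytope whose rotation group is the subgroup of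 $\Gamma^+(\mathcal{P})\times\Gamma^+(\mathcal{Q})$ generated by $(\sigma_i,\sigma_i')$, isomorphic to $W^+/(M\cap K)$. Chirality group: for rotation group $W^+/N$, $X=N\overline{N}/N$, the kernel of the natural epimorphism $W^+/N\to W^+/(N\overline N)$ (isomorphic to $N/(N\cap\overline N)$). *)

theory Defs
  imports
    "HOL-Algebra.SimpleGroups"
    "HOL-Algebra.Bij"
    "HOL-Algebra.Group_Action"
    "HOL-Algebra.Generated_Groups"
begin

section \<open>Abstract polytopes\<close>

text \<open>
  The faces are the field of the (reflexive) incidence order. In a polytope the rank function is
  determined by the order; it is carried along only to be able to name the faces of a flag.
\<close>

record 'a ranked_poset =
  incid :: "'a rel"
  rank :: "'a \<Rightarrow> int"

definition faces :: "'a ranked_poset \<Rightarrow> 'a set" where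
  "faces P = Field (incid P)"

definition flags :: "'a ranked_poset \<Rightarrow> 'a set set" where
  "flags P = {\<Phi> \<in> Chains (incid P). \<forall>C \<in> Chains (incid P). \<Phi> \<subseteq> C \<longrightarrow> C = \<Phi>}"

definition i_adjacent :: "'a ranked_poset \<Rightarrow> nat \<Rightarrow> 'a set \<Rightarrow> 'a set \<Rightarrow> bool" where
  "i_adjacent P i \<Phi> \<Psi> \<longleftrightarrow>
     \<Phi> \<in> flags P \<and> \<Psi> \<in> flags P \<and> \<Phi> \<noteq> \<Psi> \<and>
     {F \<in> \<Phi>. rank P F \<noteq> int i} = {F \<in> \<Psi>. rank P F \<noteq> int i}"

definition adjacent :: "'a ranked_poset \<Rightarrow> 'a set \<Rightarrow> 'a set \<Rightarrow> bool" where
  "adjacent P \<Phi> \<Psi> \<longleftrightarrow> (\<exists>i. i_adjacent P i \<Phi> \<Psi>)"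

text \<open>
  The conditions, in order: partial order; strictly monotone rank function; least and greatest
  face; every flag has exactly one face of each rank \<open>-1, 0, \<dots>, n\<close>; diamond condition; strong
  flag-connectedness.
\<close>

definition abstract_polytope :: "nat \<Rightarrow> 'a ranked_poset \<Rightarrow> bool" where
  "abstract_polytope n P \<longleftrightarrow>
     Partial_order (incid P) \<and>
     (\<forall>F G. (F, G) \<in> incid P \<and> F \<noteq> G \<longrightarrow> rank P F < rank P G) \<and>
     (\<exists>F \<in> faces P. \<forall>G \<in> faces P. (F, G) \<in> incid P) \<and>
     (\<exists>G \<in> faces P. \<forall>F \<in> faces P. (F, G) \<in> incid P) \<and>
     (\<forall>\<Phi> \<in> flags P. bij_betw (rank P) \<Phi> {-1..int n}) \<and>
     (\<forall>F G. (F, G) \<in> incid P \<and> rank P G = rank P F + 2 \<longrightarrow>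
        card {H. (F, H) \<in> incid P \<and> (H, G) \<in> incid P \<and> H \<noteq> F \<and> H \<noteq> G} = 2) \<and>
     (\<forall>\<Phi> \<in> flags P. \<forall>\<Psi> \<in> flags P.
        (\<Phi>, \<Psi>) \<in> {(A, B). adjacent P A B \<and> \<Phi> \<inter> \<Psi> \<subseteq> A \<and> \<Phi> \<inter> \<Psi> \<subseteq> B}\<^sup>*)"

definition adj_flag :: "'a ranked_poset \<Rightarrow> nat \<Rightarrow> 'a set \<Rightarrow> 'a set" where
  "adj_flag P i \<Phi> = (THE \<Psi>. i_adjacent P i \<Phi> \<Psi>)"

definition aut_group :: "'a ranked_poset \<Rightarrow> ('a \<Rightarrow> 'a) monoid" where
  "aut_group P = (BijGroup (faces P))
     \<lparr>carrier := {f \<in> Bij (faces P). \<forall>F \<in> faces P. \<forall>G \<in> faces P.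
                   (f F, f G) \<in> incid P \<longleftrightarrow> (F, G) \<in> incid P}\<rparr>"

section \<open>Rotation groups\<close>

text \<open>
  A group together with a sequence of distinguished elements; in rank \<open>n\<close> only
  \<open>gen G 1, \<dots>, gen G (n - 1)\<close> are relevant.
\<close>

record 'g rotary = "'g monoid" +
  gen :: "nat \<Rightarrow> 'g"

definition generated_rotary :: "nat \<Rightarrow> ('g, 'x) monoid_scheme \<Rightarrow> (nat \<Rightarrow> 'g) \<Rightarrow> 'g rotary" where
  "generated_rotary n G s =
     \<lparr>carrier = generate G (s ` {1..<n}), monoid.mult = monoid.mult G, one = monoid.one G, gen = s\<rparr>"

subsection \<open>Regular polytopes\<close>

definition regular_polytope :: "nat \<Rightarrow> 'a ranked_poset \<Rightarrow> bool" where
  "regular_polytope n P \<longleftrightarrow> abstract_polytope n P \<and>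
     (\<forall>\<Phi> \<in> flags P. \<forall>\<Psi> \<in> flags P. \<exists>f \<in> carrier (aut_group P). f ` \<Phi> = \<Psi>)"

definition reflection :: "'a ranked_poset \<Rightarrow> 'a set \<Rightarrow> nat \<Rightarrow> 'a \<Rightarrow> 'a" where
  "reflection P \<Phi> i = (THE f. f \<in> carrier (aut_group P) \<and> f ` \<Phi> = adj_flag P i \<Phi>)"

definition regular_rotation_group :: "nat \<Rightarrow> 'a ranked_poset \<Rightarrow> 'a set \<Rightarrow> ('a \<Rightarrow> 'a) rotary" where
  "regular_rotation_group n P \<Phi> = generated_rotary n (aut_group P)
     (\<lambda>i. reflection P \<Phi> (i - 1) \<otimes>\<^bsub>aut_group P\<^esub> reflection P \<Phi> i)"

text \<open>
  The rotation group of a regular polytope does not depend on the base flag, up to conjugation,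
  so neither does its index.
\<close>

definition directly_regular_polytope :: "nat \<Rightarrow> 'a ranked_poset \<Rightarrow> bool" where
  "directly_regular_polytope n P \<longleftrightarrow> regular_polytope n P \<and>
     (\<exists>\<Phi> \<in> flags P. card (rcosets\<^bsub>aut_group P\<^esub> carrier (regular_rotation_group n P \<Phi>)) = 2)"

subsection \<open>Chiral polytopes\<close>

definition chiral_polytope :: "nat \<Rightarrow> 'a ranked_poset \<Rightarrow> bool" where
  "chiral_polytope n P \<longleftrightarrow> abstract_polytope n P \<and>
     card (orbits (aut_group P) (flags P) (\<lambda>f \<Phi>. f ` \<Phi>)) = 2 \<and>
     (\<forall>\<Phi> \<Psi>. adjacent P \<Phi> \<Psi> \<longrightarrow>
        orbit (aut_group P) (\<lambda>f \<Phi>. f ` \<Phi>) \<Phi> \<noteq> orbit (aut_group P) (\<lambda>f \<Phi>. f ` \<Phi>) \<Psi>)"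

text \<open>
  Automorphisms are composed as functions, so they act on the left. Where \<open>\<rho>\<^sub>i\<close> maps the base flag
  \<open>\<Phi>\<close> to its \<open>i\<close>-adjacent flag, the product \<open>\<rho>\<^bsub>i-1\<^esub> \<rho>\<^sub>i\<close> maps \<open>\<Phi>\<close> to the \<open>i\<close>-adjacent flag of the
  \<open>(i-1)\<close>-adjacent flag of \<open>\<Phi>\<close>. The standard rotations of a chiral polytope, in which no \<open>\<rho>\<^sub>i\<close>
  exists, are defined by the same action on \<open>\<Phi>\<close>. (For right actions, the two adjacencies are applied
  in the opposite order; inversion is an isomorphism between the two versions of the group which
  respects the generators.)
\<close>

definition chiral_rotation :: "'a ranked_poset \<Rightarrow> 'a set \<Rightarrow> nat \<Rightarrow> 'a \<Rightarrow> 'a" where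
  "chiral_rotation P \<Phi> i =
     (THE f. f \<in> carrier (aut_group P) \<and> f ` \<Phi> = adj_flag P i (adj_flag P (i - 1) \<Phi>))"

definition chiral_rotation_group :: "nat \<Rightarrow> 'a ranked_poset \<Rightarrow> 'a set \<Rightarrow> ('a \<Rightarrow> 'a) rotary" where
  "chiral_rotation_group n P \<Phi> = generated_rotary n (aut_group P) (chiral_rotation P \<Phi>)"

subsection \<open>Mixing\<close>

text \<open>
  The mix of two polytopes is determined by its rotation group with the distinguished generators,
  and is represented by it. (It need not be a polytope.)
\<close>

definition mix :: "nat \<Rightarrow> 'g rotary \<Rightarrow> 'h rotary \<Rightarrow> ('g \<times> 'h) rotary" where
  "mix n G H = generated_rotary n (G \<times>\<times> H) (\<lambda>i. (gen G i, gen H i))"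

section \<open>Group presentations\<close>

text \<open>A letter \<open>(x, True)\<close> stands for the generator \<open>x\<close> and \<open>(x, False)\<close> for its inverse.\<close>

type_synonym 'x word = "('x \<times> bool) list"

definition words :: "'x set \<Rightarrow> 'x word set" where
  "words X = lists (X \<times> UNIV)"

inductive_set pres_rel :: "'x set \<Rightarrow> 'x word set \<Rightarrow> 'x word rel"
  for X :: "'x set" and R :: "'x word set" where
  refl: "w \<in> words X \<Longrightarrow> (w, w) \<in> pres_rel X R"
| sym: "(v, w) \<in> pres_rel X R \<Longrightarrow> (w, v) \<in> pres_rel X R"
| trans: "(u, v) \<in> pres_rel X R \<Longrightarrow> (v, w) \<in> pres_rel X R \<Longrightarrow> (u, w) \<in> pres_rel X R"
| cancel: "u \<in> words X \<Longrightarrow> v \<in> words X \<Longrightarrow> x \<in> X \<Longrightarrow>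
    (u @ [(x, b), (x, \<not> b)] @ v, u @ v) \<in> pres_rel X R"
| relator: "u \<in> words X \<Longrightarrow> v \<in> words X \<Longrightarrow> r \<in> R \<Longrightarrow> r \<in> words X \<Longrightarrow>
    (u @ r @ v, u @ v) \<in> pres_rel X R"

definition presented_group :: "'x set \<Rightarrow> 'x word set \<Rightarrow> 'x word set monoid" where
  "presented_group X R =
     \<lparr>carrier = words X // pres_rel X R,
      monoid.mult = \<lambda>A B. \<Union>a \<in> A. \<Union>b \<in> B. pres_rel X R `` {a @ b},
      one = pres_rel X R `` {[]}\<rparr>"

definition word_eval :: "('g, 'y) monoid_scheme \<Rightarrow> ('x \<Rightarrow> 'g) \<Rightarrow> 'x word \<Rightarrow> 'g" where
  "word_eval G s w =
     foldr (\<lambda>(x, b) g. (if b then s x else inv\<^bsub>G\<^esub> s x) \<otimes>\<^bsub>G\<^esub> g) w \<one>\<^bsub>G\<^esub>"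

text \<open>
  The homomorphism from a presented group which maps the generators as prescribed by \<open>s\<close>, provided
  that the relators evaluate to \<open>1\<close>; see \<open>pres_hom_hom\<close> and \<open>pres_hom_generator\<close>.
\<close>

definition pres_hom :: "('g, 'y) monoid_scheme \<Rightarrow> ('x \<Rightarrow> 'g) \<Rightarrow> 'x word set \<Rightarrow> 'g" where
  "pres_hom G s A = the_elem (word_eval G s ` A)"

lemma pres_rel_words: "(v, w) \<in> pres_rel X R \<Longrightarrow> v \<in> words X \<and> w \<in> words X"
  by (induction rule: pres_rel.induct) (auto simp: words_def)

lemma equiv_pres_rel: "equiv (words X) (pres_rel X R)"
proof (rule equivI)
  show "pres_rel X R \<subseteq> words X \<times> words X"
    using pres_rel_words by fast
  show "refl_on (words X) (pres_rel X R)"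
    by (rule refl_onI) (rule pres_rel.refl)
  show "Relation.sym (pres_rel X R)"
    by (rule symI) (rule pres_rel.sym)
  show "Relation.trans (pres_rel X R)"
    by (rule transI) (rule pres_rel.trans)
qed

lemma pres_rel_append_left:
  "(v, w) \<in> pres_rel X R \<Longrightarrow> t \<in> words X \<Longrightarrow> (t @ v, t @ w) \<in> pres_rel X R"
proof (induction rule: pres_rel.induct)
  case (cancel u v x b)
  then show ?case using pres_rel.cancel[of "t @ u" X v x b R] by (simp add: words_def)
next
  case (relator u v r)
  then show ?case using pres_rel.relator[of "t @ u" X v r R] by (simp add: words_def)
next
  case (refl w)
  then show ?case by (intro pres_rel.refl) (simp add: words_def)
next
  case (sym v w)
  then show ?case by (meson pres_rel.sym)
next
  case (trans u v w)
  then show ?case by (meson pres_rel.trans)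
qed

lemma pres_rel_append_right:
  "(v, w) \<in> pres_rel X R \<Longrightarrow> t \<in> words X \<Longrightarrow> (v @ t, w @ t) \<in> pres_rel X R"
proof (induction rule: pres_rel.induct)
  case (cancel u v x b)
  then show ?case using pres_rel.cancel[of u X "v @ t" x b R] by (simp add: words_def)
next
  case (relator u v r)
  then show ?case using pres_rel.relator[of u X "v @ t" r R] by (simp add: words_def)
next
  case (refl w)
  then show ?case by (intro pres_rel.refl) (simp add: words_def)
next
  case (sym v w)
  then show ?case by (meson pres_rel.sym)
next
  case (trans u v w)
  then show ?case by (meson pres_rel.trans)
qed

lemma pres_rel_append:
  assumes "(a, a') \<in> pres_rel X R" "(b, b') \<in> pres_rel X R"
  shows "(a @ b, a' @ b') \<in> pres_rel X R"
  by (meson assms pres_rel.trans pres_rel_append_left pres_rel_append_right pres_rel_words)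

lemma presented_mult:
  assumes "a \<in> words X" "b \<in> words X"
  shows "pres_rel X R `` {a} \<otimes>\<^bsub>presented_group X R\<^esub> pres_rel X R `` {b} = pres_rel X R `` {a @ b}"
proof -
  have eq: "pres_rel X R `` {a' @ b'} = pres_rel X R `` {a @ b}"
    if "(a, a') \<in> pres_rel X R" "(b, b') \<in> pres_rel X R" for a' b'
    using equiv_class_eq[OF equiv_pres_rel pres_rel_append[OF that]] by simp
  have "(\<Union>a' \<in> pres_rel X R `` {a}. \<Union>b' \<in> pres_rel X R `` {b}. pres_rel X R `` {a' @ b'})
      = (\<Union>a' \<in> pres_rel X R `` {a}. \<Union>b' \<in> pres_rel X R `` {b}. pres_rel X R `` {a @ b})"
    by (intro SUP_cong refl eq) auto
  also have "\<dots> = pres_rel X R `` {a @ b}"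
    using pres_rel.refl[OF assms(1), of R] pres_rel.refl[OF assms(2), of R] by blast
  finally show ?thesis by (simp add: presented_group_def)
qed

lemma group_presented_group: "group (presented_group X R)"
proof (rule groupI)
  let ?G = "presented_group X R" and ?c = "\<lambda>w. pres_rel X R `` {w}"
  have car: "A \<in> carrier ?G \<longleftrightarrow> (\<exists>w \<in> words X. A = ?c w)" for A
    by (auto simp: presented_group_def quotient_def)
  have one: "\<one>\<^bsub>?G\<^esub> = ?c []" and nil: "[] \<in> words X"
    by (auto simp: presented_group_def words_def)
  have app: "a @ b \<in> words X" if "a \<in> words X" "b \<in> words X" for a b
    using that by (simp add: words_def)
  show "\<one>\<^bsub>?G\<^esub> \<in> carrier ?G"
    using one nil car by auto
  fix A assume A: "A \<in> carrier ?G"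
  then obtain a where a: "a \<in> words X" "A = ?c a" using car by auto
  show "\<one>\<^bsub>?G\<^esub> \<otimes>\<^bsub>?G\<^esub> A = A"
    using a nil by (simp add: one presented_mult)
  have "\<exists>b \<in> words X. (b @ a, []) \<in> pres_rel X R"
    using a(1)
  proof (induction a)
    case Nil
    then show ?case by (force intro: pres_rel.refl simp: words_def)
  next
    case (Cons l a)
    obtain x e where l: "l = (x, e)" "x \<in> X" and aw: "a \<in> words X"
      using Cons.prems by (cases l) (auto simp: words_def)
    then obtain b where b: "b \<in> words X" "(b @ a, []) \<in> pres_rel X R"
      using Cons.IH by auto
    have "(b @ [(x, \<not> e), (x, \<not> \<not> e)] @ a, b @ a) \<in> pres_rel X R"
      by (rule pres_rel.cancel) (use b aw l in auto)
    then have "((b @ [(x, \<not> e)]) @ l # a, []) \<in> pres_rel X R"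
      using b(2) l by (auto intro: pres_rel.trans)
    then show ?case
      using b(1) l by (intro bexI[of _ "b @ [(x, \<not> e)]"]) (auto simp: words_def)
  qed
  then obtain b where b: "b \<in> words X" "(b @ a, []) \<in> pres_rel X R" by auto
  then have "?c b \<otimes>\<^bsub>?G\<^esub> A = \<one>\<^bsub>?G\<^esub>"
    using a equiv_class_eq[OF equiv_pres_rel b(2)] by (simp add: presented_mult one)
  then show "\<exists>B \<in> carrier ?G. B \<otimes>\<^bsub>?G\<^esub> A = \<one>\<^bsub>?G\<^esub>"
    using b car by auto
  fix B assume B: "B \<in> carrier ?G"
  then obtain b where b: "b \<in> words X" "B = ?c b" using car by auto
  show "A \<otimes>\<^bsub>?G\<^esub> B \<in> carrier ?G"
    using a b app by (auto simp: presented_mult car)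
  fix C assume C: "C \<in> carrier ?G"
  then obtain c where c: "c \<in> words X" "C = ?c c" using car by auto
  show "A \<otimes>\<^bsub>?G\<^esub> B \<otimes>\<^bsub>?G\<^esub> C = A \<otimes>\<^bsub>?G\<^esub> (B \<otimes>\<^bsub>?G\<^esub> C)"
    using a b c app by (simp add: presented_mult)
qed

lemma (in group) word_eval_closed:
  "s \<in> X \<rightarrow> carrier G \<Longrightarrow> w \<in> words X \<Longrightarrow> word_eval G s w \<in> carrier G"
  by (induction w) (auto simp: word_eval_def words_def Pi_def)

lemma (in group) word_eval_append:
  assumes "s \<in> X \<rightarrow> carrier G" "v \<in> words X" "w \<in> words X"
  shows "word_eval G s (v @ w) = word_eval G s v \<otimes> word_eval G s w"
  using assms(2)
proof (induction v)
  case Nil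
  then show ?case using word_eval_closed[OF assms(1,3)] by (simp add: word_eval_def)
next
  case (Cons l v)
  obtain x b where l: "l = (x, b)" "x \<in> X" and v: "v \<in> words X"
    using Cons.prems by (cases l) (auto simp: words_def)
  then have "s x \<in> carrier G" using assms(1) by auto
  then show ?case
    using Cons.IH[OF v] l word_eval_closed[OF assms(1,3)] word_eval_closed[OF assms(1) v]
    by (auto simp: word_eval_def m_assoc)
qed

lemma (in group) word_eval_pres_rel:
  assumes s: "s \<in> X \<rightarrow> carrier G" and R: "\<And>r. r \<in> R \<Longrightarrow> word_eval G s r = \<one>"
    and vw: "(v, w) \<in> pres_rel X R"
  shows "word_eval G s v = word_eval G s w"
  using vw
proof (induction rule: pres_rel.induct)
  case (cancel u v x b)
  have x: "s x \<in> carrier G" and xw: "[(x, b), (x, \<not> b)] \<in> words X"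
    using s cancel by (auto simp: words_def)
  have "word_eval G s [(x, b), (x, \<not> b)] = \<one>"
    using x by (cases b) (auto simp: word_eval_def)
  moreover have "[(x, b), (x, \<not> b)] @ v \<in> words X"
    using xw cancel by (simp add: words_def)
  ultimately show ?case
    using cancel xw word_eval_closed[OF s]
    by (simp only: word_eval_append[OF s] l_one)
next
  case (relator u v r)
  have "r @ v \<in> words X" using relator by (simp add: words_def)
  then show ?case
    using relator R word_eval_closed[OF s] by (simp add: word_eval_append[OF s])
qed auto

lemma (in group) pres_hom_class:
  assumes s: "s \<in> X \<rightarrow> carrier G" and R: "\<And>r. r \<in> R \<Longrightarrow> word_eval G s r = \<one>"
    and w: "w \<in> words X"
  shows "pres_hom G s (pres_rel X R `` {w}) = word_eval G s w"
proof -
  have "word_eval G s ` (pres_rel X R `` {w}) = {word_eval G s w}"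
  proof (intro equalityI subsetI)
    fix g assume "g \<in> word_eval G s ` (pres_rel X R `` {w})"
    then obtain v where "(w, v) \<in> pres_rel X R" "g = word_eval G s v" by blast
    then show "g \<in> {word_eval G s w}"
      by (metis singletonI word_eval_pres_rel[OF s R])
  next
    fix g assume "g \<in> {word_eval G s w}"
    then show "g \<in> word_eval G s ` (pres_rel X R `` {w})"
      using pres_rel.refl[OF w, of R] by blast
  qed
  then show ?thesis by (simp add: pres_hom_def)
qed

lemma (in group) pres_hom_hom:
  assumes s: "s \<in> X \<rightarrow> carrier G" and R: "\<And>r. r \<in> R \<Longrightarrow> word_eval G s r = \<one>"
  shows "pres_hom G s \<in> hom (presented_group X R) G"
proof (rule homI)
  have car: "A \<in> carrier (presented_group X R) \<longleftrightarrow> (\<exists>w \<in> words X. A = pres_rel X R `` {w})" for A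
    by (auto simp: presented_group_def quotient_def)
  fix A assume "A \<in> carrier (presented_group X R)"
  then obtain a where a: "a \<in> words X" "A = pres_rel X R `` {a}" using car by auto
  then show "pres_hom G s A \<in> carrier G"
    by (simp add: pres_hom_class[OF s R] word_eval_closed[OF s])
  fix B assume "B \<in> carrier (presented_group X R)"
  then obtain b where b: "b \<in> words X" "B = pres_rel X R `` {b}" using car by auto
  have "a @ b \<in> words X" using a b by (simp add: words_def)
  then show "pres_hom G s (A \<otimes>\<^bsub>presented_group X R\<^esub> B) = pres_hom G s A \<otimes> pres_hom G s B"
    using a b by (simp add: presented_mult pres_hom_class[OF s R] word_eval_append[OF s])
qed

lemma (in group) pres_hom_generator:
  assumes s: "s \<in> X \<rightarrow> carrier G" and R: "\<And>r. r \<in> R \<Longrightarrow> word_eval G s r = \<one>" and x: "x \<in> X"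
  shows "pres_hom G s (pres_rel X R `` {[(x, True)]}) = s x"
proof -
  have "s x \<in> carrier G" and "[(x, True)] \<in> words X" using s x by (auto simp: words_def)
  then show ?thesis by (simp add: pres_hom_class[OF s R]) (simp add: word_eval_def)
qed

section \<open>The chirality group\<close>

definition Wplus_relators :: "nat \<Rightarrow> nat word set" where
  "Wplus_relators n =
     {concat (replicate 2 (map (\<lambda>k. (k, True)) [i..<Suc j])) | i j. 1 \<le> i \<and> i < j \<and> j \<le> n - 1}"

definition Wplus :: "nat \<Rightarrow> nat word set monoid" where
  "Wplus n = presented_group {1..<n} (Wplus_relators n)"

definition Wplus_gen :: "nat \<Rightarrow> nat \<Rightarrow> nat word set" where
  "Wplus_gen n i = pres_rel {1..<n} (Wplus_relators n) `` {[(i, True)]}"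

text \<open>The automorphism \<open>w \<mapsto> \<^emph>\<open>overline\<close> w\<close> of \<open>W\<^sup>+\<close>.\<close>

definition conj_aut :: "nat \<Rightarrow> nat word set \<Rightarrow> nat word set" where
  "conj_aut n = pres_hom (Wplus n)
     (\<lambda>j. if j = 1 then inv\<^bsub>Wplus n\<^esub> Wplus_gen n 1
          else if j = 2 then Wplus_gen n 1 [^]\<^bsub>Wplus n\<^esub> (2::nat) \<otimes>\<^bsub>Wplus n\<^esub> Wplus_gen n 2
          else Wplus_gen n j)"

text \<open>The normal subgroup \<open>N\<close> of \<open>W\<^sup>+\<close> such that \<open>G = W\<^sup>+/N\<close>, with generators corresponding.\<close>

definition rel_subgroup :: "nat \<Rightarrow> 'g rotary \<Rightarrow> nat word set set" where
  "rel_subgroup n G = kernel (Wplus n) G (pres_hom G (gen G))"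

definition chirality_group :: "nat \<Rightarrow> 'g rotary \<Rightarrow> nat word set set monoid" where
  "chirality_group n G =
     (let N = rel_subgroup n G
      in (Wplus n)\<lparr>carrier := N <#>\<^bsub>Wplus n\<^esub> (conj_aut n ` N)\<rparr> Mod N)"

text \<open>
  Let \<open>N\<close> be the normal subgroup of \<open>W\<^sup>+\<close> belonging to \<open>H\<close>. For a normal subgroup \<open>M \<le> N\<close>, this is
  the natural projection from \<open>W\<^sup>+/M\<close> to \<open>W\<^sup>+/N\<close>, mapping the coset \<open>Mw\<close> to \<open>Nw\<close>.
\<close>

definition natural_projection :: "nat \<Rightarrow> 'g rotary \<Rightarrow> nat word set set \<Rightarrow> nat word set set" where
  "natural_projection n H C = rel_subgroup n H <#>\<^bsub>Wplus n\<^esub> C"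

end

theory Submission
  imports Defs "HOL-Algebra.Zassenhaus"
begin

text \<open>
  Write \<open>\<Gamma>(P) = W\<^sup>+/M\<close> and \<open>\<Gamma>(Q) = W\<^sup>+/K\<close>, and let \<open>M'\<close>, \<open>K'\<close> be the images of \<open>M\<close>, \<open>K\<close> under
  \<open>w \<mapsto> \<^emph>\<open>overline\<close> w\<close>. As \<open>Q\<close> is regular, this automorphism induces conjugation by \<open>\<rho>\<^sub>0\<close> on \<open>\<Gamma>(Q)\<close>,
  so \<open>K' = K\<close>; the mix belongs to \<open>N = M \<inter> K\<close>, and \<open>N' = M' \<inter> K\<close>. The projection
  \<open>N N'/N \<rightarrow> M M'/M\<close> is injective because \<open>M \<inter> N N' \<subseteq> M \<inter> K = N\<close>. It is surjective if
  \<open>M' \<subseteq> M (M' \<inter> K)\<close>. By simplicity of \<open>W\<^sup>+/K\<close>, this could only fail if \<open>M \<inter> M' \<subseteq> K\<close> while \<open>M\<close> and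
  \<open>M'\<close> both map onto \<open>W\<^sup>+/K\<close>. But then \<open>[M, M'] \<subseteq> M \<inter> M' \<subseteq> K\<close> makes \<open>W\<^sup>+/K\<close> abelian, which is
  impossible in rank at least 3; in rank 2 the automorphism is inversion and \<open>M' = M\<close>.
\<close>

section \<open>Normal subgroups and simple quotients\<close>

text \<open>Normal subgroups of \<open>W\<close> map onto normal subgroups of the simple group
  \<open>S\<close>, so onto \<open>S\<close> or to 1. If \<open>M \<inter> M'\<close> maps onto
  \<open>S\<close>, it can correct elements of \<open>M'\<close> into the kernel. Otherwise
  commutators force the images of \<open>M\<close> and \<open>M'\<close> to commute elementwise, and
  \<open>nc\<close> and \<open>sub\<close> leave only the case that \<open>M'\<close> lies in the
  kernel.\<close>

lemma normal_subset_set_mult_Int_kernel: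
  assumes "group_hom W S h" and surj: "h ` carrier W = carrier S" and "simple_group S"
    and nc: "x \<in> carrier S" "y \<in> carrier S" "x \<otimes>\<^bsub>S\<^esub> y \<noteq> y \<otimes>\<^bsub>S\<^esub> x"
    and M: "M \<lhd> W" and M': "M' \<lhd> W"
    and sub: "M \<subseteq> kernel W S h \<Longrightarrow> M' \<subseteq> kernel W S h"
  shows "M' \<subseteq> M <#>\<^bsub>W\<^esub> (M' \<inter> kernel W S h)"
proof -
  interpret group_hom W S h by fact
  interpret S: simple_group S by fact
  interpret M: normal M W by fact
  interpret M': normal M' W by fact
  let ?K = "kernel W S h"
  have dich: "h ` D = carrier S \<or> D \<subseteq> ?K" if D: "D \<lhd> W" for D
  proof -
    have "h ` D = carrier S \<or> h ` D = {\<one>\<^bsub>S\<^esub>}"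
      using S.no_real_normal_subgroup normal.surj_hom_normal_subgroup[OF D _ surj] group_hom_axioms
      by blast
    moreover have "D \<subseteq> carrier W" using D by (simp add: normal_imp_subgroup subgroup.subset)
    ultimately show ?thesis by (auto simp: kernel_def)
  qed
  show ?thesis
  proof (cases "h ` (M \<inter> M') = carrier S")
    case True
    show ?thesis
    proof
      fix m assume m: "m \<in> M'"
      then have "h m \<in> h ` (M \<inter> M')" using True by auto
      \<comment> \<open>\<open>d\<close> is the factor in \<open>M\<close>: as it has the same image
        as \<open>m\<close>, dividing it off leaves an element of \<open>M'\<close> in the
        kernel.\<close>
      then obtain d where d: "d \<in> M" "d \<in> M'" "h d = h m" by auto
      have car: "d \<in> carrier W" "m \<in> carrier W" using d m by auto
      have "inv\<^bsub>W\<^esub> d \<otimes>\<^bsub>W\<^esub> m \<in> M' \<inter> ?K"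
        using d m car by (auto simp: kernel_def)
      moreover have "m = d \<otimes>\<^bsub>W\<^esub> (inv\<^bsub>W\<^esub> d \<otimes>\<^bsub>W\<^esub> m)"
        using car by (simp add: G.m_assoc[symmetric])
      ultimately show "m \<in> M <#>\<^bsub>W\<^esub> (M' \<inter> ?K)"
        using d by (auto simp: set_mult_def)
    qed
  next
    case False
    then have I: "M \<inter> M' \<subseteq> ?K" using dich G.normal_subgroup_intersect[OF M M'] by blast
    have comm: "h a \<otimes>\<^bsub>S\<^esub> h b = h b \<otimes>\<^bsub>S\<^esub> h a" if a: "a \<in> M" and b: "b \<in> M'" for a b
    proof -
      have car: "a \<in> carrier W" "b \<in> carrier W" using a b by auto
      \<comment> \<open>The commutator lies in \<open>M'\<close> when bracketed as (a b a^-1) b^-1,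
        and in \<open>M\<close> when bracketed as a (b a^-1 b^-1).\<close>
      let ?c = "a \<otimes>\<^bsub>W\<^esub> b \<otimes>\<^bsub>W\<^esub> inv\<^bsub>W\<^esub> a \<otimes>\<^bsub>W\<^esub> inv\<^bsub>W\<^esub> b"
      have "?c \<in> M'"
        using M'.inv_op_closed2[OF car(1) b] b by simp
      moreover have "?c = a \<otimes>\<^bsub>W\<^esub> (b \<otimes>\<^bsub>W\<^esub> inv\<^bsub>W\<^esub> a \<otimes>\<^bsub>W\<^esub> inv\<^bsub>W\<^esub> b)"
        using car by (simp add: G.m_assoc)
      then have "?c \<in> M" using M.inv_op_closed2[OF car(2), of "inv\<^bsub>W\<^esub> a"] a by simp
      ultimately have "?c \<in> ?K" using I by blast
      then have 1: "h a \<otimes>\<^bsub>S\<^esub> h b \<otimes>\<^bsub>S\<^esub> inv\<^bsub>S\<^esub> h a \<otimes>\<^bsub>S\<^esub> inv\<^bsub>S\<^esub> h b = \<one>\<^bsub>S\<^esub>"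
        using car by (simp add: kernel_def)
      have hc: "h a \<in> carrier S" "h b \<in> carrier S" using car by auto
      have "h a \<otimes>\<^bsub>S\<^esub> h b = (h a \<otimes>\<^bsub>S\<^esub> h b \<otimes>\<^bsub>S\<^esub> inv\<^bsub>S\<^esub> h a \<otimes>\<^bsub>S\<^esub> inv\<^bsub>S\<^esub> h b) \<otimes>\<^bsub>S\<^esub> (h b \<otimes>\<^bsub>S\<^esub> h a)"
        using hc by (simp add: H.m_assoc) (simp add: H.m_assoc[symmetric])
      then show ?thesis using 1 hc by simp
    qed
    have "M' \<subseteq> ?K"
    proof (rule ccontr)
      assume "\<not> M' \<subseteq> ?K"
      \<comment> \<open>By \<open>sub\<close>, \<open>M\<close> is not in the kernel either. Both
        subgroups then map onto \<open>S\<close>, so the non-commuting \<open>x\<close> and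
        \<open>y\<close> have preimages in \<open>M\<close> and \<open>M'\<close>.\<close>
      then have "h ` M = carrier S" "h ` M' = carrier S"
        using dich M M' sub by blast+
      then obtain a b where "a \<in> M" "x = h a" "b \<in> M'" "y = h b"
        using nc(1,2) by (metis imageE)
      then show False using comm[of a b] nc(3) by metis
    qed
    moreover have "m \<in> M <#>\<^bsub>W\<^esub> (M' \<inter> ?K)" if "m \<in> M'" "m \<in> ?K" for m
      unfolding set_mult_def using that M.one_closed
      by (intro UN_I[of "\<one>\<^bsub>W\<^esub>"] UN_I[of m]) auto
    ultimately show ?thesis by blast
  qed
qed

text \<open>The map sends \<open>N a\<close> to \<open>M a\<close> because
  \<open>N \<subseteq> M\<close>. If \<open>M a = M b\<close> with \<open>a\<close>,
  \<open>b\<close> in \<open>L\<close>, then a b^-1 lies in \<open>M \<inter> L\<close>, so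
  \<open>inj\<close> gives injectivity; by \<open>surj\<close> every coset \<open>M a\<close> with
  \<open>a\<close> in \<open>L'\<close> has a representative in \<open>L\<close>.\<close>

lemma (in group) set_mult_iso_FactGroup:
  assumes M: "M \<lhd> G" and N: "N \<lhd> G" and L: "subgroup L G" and L': "subgroup L' G"
    and "N \<subseteq> M" "L \<subseteq> L'" and inj: "M \<inter> L \<subseteq> N" and surj: "L' \<subseteq> M <#> L"
  shows "(\<lambda>C. M <#> C) \<in> iso (G\<lparr>carrier := L\<rparr> Mod N) (G\<lparr>carrier := L'\<rparr> Mod M)"
proof -
  interpret M: normal M G by fact
  interpret N: normal N G by fact
  interpret L: subgroup L G by fact
  interpret L': subgroup L' G by fact
  have car: "carrier (G\<lparr>carrier := H\<rparr> Mod A) = (\<lambda>a. A #> a) ` H" for H A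
    by (simp add: carrier_FactGroup r_coset_def)
  \<comment> \<open>Restricting the carrier leaves the product untouched, so cosets are multiplied
    as subsets of \<open>G\<close>.\<close>
  have mult: "monoid.mult (G\<lparr>carrier := H\<rparr> Mod A) = (<#>)" for H A
    by (simp add: set_mult_def fun_eq_iff)
  have MN: "M <#> N = M"
  proof
    show "M <#> N \<subseteq> M" using \<open>N \<subseteq> M\<close> by (auto simp: set_mult_def)
    show "M \<subseteq> M <#> N" 
    proof
      fix m assume "m \<in> M"
      then show "m \<in> M <#> N"
        unfolding set_mult_def using N.one_closed by (intro UN_I[of m] UN_I[of \<one>]) auto
    qed
  qed
  have proj: "M <#> (N #> a) = M #> a" if "a \<in> carrier G" for a
    using setmult_rcos_assoc[OF M.subset N.subset that] MN by simp
  show ?thesis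
  proof (rule isoI)
    show "(\<lambda>C. M <#> C) \<in> hom (G\<lparr>carrier := L\<rparr> Mod N) (G\<lparr>carrier := L'\<rparr> Mod M)"
    proof (rule homI)
      fix A assume "A \<in> carrier (G\<lparr>carrier := L\<rparr> Mod N)"
      then obtain a where a: "a \<in> L" "A = N #> a" unfolding car by blast
      then show "M <#> A \<in> carrier (G\<lparr>carrier := L'\<rparr> Mod M)"
        using \<open>L \<subseteq> L'\<close> by (auto simp: car proj)
      fix B assume "B \<in> carrier (G\<lparr>carrier := L\<rparr> Mod N)"
      then obtain b where b: "b \<in> L" "B = N #> b" unfolding car by blast
      show "M <#> (A \<otimes>\<^bsub>G\<lparr>carrier := L\<rparr> Mod N\<^esub> B) = (M <#> A) \<otimes>\<^bsub>G\<lparr>carrier := L'\<rparr> Mod M\<^esub> (M <#> B)"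
        using a b by (simp only: mult) (simp add: proj N.rcos_sum M.rcos_sum)
    qed
    show "bij_betw (\<lambda>C. M <#> C) (carrier (G\<lparr>carrier := L\<rparr> Mod N)) (carrier (G\<lparr>carrier := L'\<rparr> Mod M))"
      unfolding bij_betw_def
    proof
      show "inj_on (\<lambda>C. M <#> C) (carrier (G\<lparr>carrier := L\<rparr> Mod N))"
      proof (rule inj_onI)
        fix A B assume "A \<in> carrier (G\<lparr>carrier := L\<rparr> Mod N)" "B \<in> carrier (G\<lparr>carrier := L\<rparr> Mod N)"
        then obtain a b where a: "a \<in> L" "A = N #> a" and b: "b \<in> L" "B = N #> b"
          unfolding car by blast
        assume "M <#> A = M <#> B"
        then have "M #> a = M #> b" using a b by (simp add: proj)
        then have "a \<in> M #> b" using rcos_self[OF _ M.is_subgroup, of a] a by simp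
        then have "a \<otimes> inv b \<in> M" using M.rcos_module_imp[OF is_group] a b by simp
        moreover have "a \<otimes> inv b \<in> L" using a b by simp
        ultimately have "a \<otimes> inv b \<in> N" using inj by blast
        then have "a \<in> N #> b" using N.rcos_module_rev[OF is_group] a b by simp
        then show "A = B" using a b repr_independence[OF _ _ N.is_subgroup] by simp
      qed
      show "(\<lambda>C. M <#> C) ` carrier (G\<lparr>carrier := L\<rparr> Mod N) = carrier (G\<lparr>carrier := L'\<rparr> Mod M)"
      proof
        show "(\<lambda>C. M <#> C) ` carrier (G\<lparr>carrier := L\<rparr> Mod N) \<subseteq> carrier (G\<lparr>carrier := L'\<rparr> Mod M)"
          using \<open>L \<subseteq> L'\<close> by (auto simp: car proj)
        show "carrier (G\<lparr>carrier := L'\<rparr> Mod M) \<subseteq> (\<lambda>C. M <#> C) ` carrier (G\<lparr>carrier := L\<rparr> Mod N)"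
        proof
          fix A assume "A \<in> carrier (G\<lparr>carrier := L'\<rparr> Mod M)"
          then obtain a where a: "a \<in> L'" "A = M #> a" unfolding car by blast
          then obtain m k where mk: "m \<in> M" "k \<in> L" "a = m \<otimes> k"
            using surj by (auto simp: set_mult_def)
          then have "a \<in> M #> k" by (auto simp: r_coset_def)
          then have "M #> k = M #> a" using mk repr_independence[OF _ _ M.is_subgroup] by simp
          then show "A \<in> (\<lambda>C. M <#> C) ` carrier (G\<lparr>carrier := L\<rparr> Mod N)"
            unfolding car using a mk by (intro image_eqI[of _ _ "N #> k"]) (auto simp: proj)
        qed
      qed
    qed
  qed
qed

section \<open>The presentation of \<open>W\<^sup>+\<close>\<close>

lemma carrier_presented_group:
  "carrier (presented_group X R) = (\<lambda>w. pres_rel X R `` {w}) ` words X"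
  by (auto simp: presented_group_def quotient_def)

text \<open>A converse to \<open>pres_hom_hom\<close>: every homomorphism is evaluation at the
  images of the generators. With the identity as \<open>h\<close> it also writes each element as a
  word in the generators.\<close>

lemma presented_hom_class:
  assumes "group H" and h: "h \<in> hom (presented_group X R) H" and w: "w \<in> words X"
  shows "h (pres_rel X R `` {w}) = word_eval H (\<lambda>x. h (pres_rel X R `` {[(x, True)]})) w"
proof -
  interpret group_hom "presented_group X R" H h
    using assms group_presented_group by (simp add: group_hom_def group_hom_axioms_def)
  have one: "\<one>\<^bsub>presented_group X R\<^esub> = pres_rel X R `` {[]}"
    by (simp add: presented_group_def)
  from w show ?thesis
  proof (induction w)
    case Nil
    then show ?case using hom_one by (simp add: word_eval_def one)
  next
    case (Cons l w)
    obtain x b where l: "l = (x, b)" "x \<in> X" and w: "w \<in> words X"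
      using Cons.prems by (cases l) (auto simp: words_def)
    have lw: "[(x, c)] \<in> words X" for c using l by (simp add: words_def)
    let ?c = "\<lambda>w. pres_rel X R `` {w}"
    have car: "?c v \<in> carrier (presented_group X R)" if "v \<in> words X" for v
      using that by (simp add: carrier_presented_group)
    have "h (?c (l # w)) = h (?c [l]) \<otimes>\<^bsub>H\<^esub> h (?c w)"
      using presented_mult[OF lw[of b] w, where R = R] l car[OF lw] car[OF w] by (metis append_Cons append_Nil hom_mult)
    moreover have "h (?c [l]) = (if b then h (?c [(x, True)]) else inv\<^bsub>H\<^esub> h (?c [(x, True)]))"
    proof (cases b)
      case False
      \<comment> \<open>The cancellation rule between empty words identifies the class of the
        inverse letter as the inverse of the generator.\<close>
      have "([] @ [(x, False), (x, \<not> False)] @ [], [] @ []) \<in> pres_rel X R"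
        by (rule pres_rel.cancel) (use l in \<open>auto simp: words_def\<close>)
      then have "?c ([(x, False)] @ [(x, True)]) = ?c []"
        by (simp add: equiv_class_eq[OF equiv_pres_rel])
      then have "?c [(x, False)] \<otimes>\<^bsub>presented_group X R\<^esub> ?c [(x, True)] = \<one>\<^bsub>presented_group X R\<^esub>"
        using presented_mult[OF lw lw] one by simp
      then have "?c [(x, False)] = inv\<^bsub>presented_group X R\<^esub> ?c [(x, True)]"
        using car[OF lw] G.inv_equality by metis
      then show ?thesis using False l car[OF lw] by simp
    qed (simp add: l)
    ultimately show ?case using Cons.IH[OF w] l by (auto simp: word_eval_def)
  qed
qed

lemma presented_hom_eqI:
  assumes "group H" and g: "g \<in> hom (presented_group X R) H" and h: "h \<in> hom (presented_group X R) H"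
    and gens: "\<And>x. x \<in> X \<Longrightarrow> g (pres_rel X R `` {[(x, True)]}) = h (pres_rel X R `` {[(x, True)]})"
    and A: "A \<in> carrier (presented_group X R)"
  shows "g A = h A"
proof -
  obtain w where w: "w \<in> words X" "A = pres_rel X R `` {w}"
    using A by (auto simp: carrier_presented_group)
  have "word_eval H (\<lambda>x. g (pres_rel X R `` {[(x, True)]})) w
      = word_eval H (\<lambda>x. h (pres_rel X R `` {[(x, True)]})) w"
    using w(1) gens by (induction w) (auto simp: word_eval_def words_def)
  then show ?thesis
    using presented_hom_class[OF assms(1) g w(1)] presented_hom_class[OF assms(1) h w(1)] w(2) by simp
qed

text \<open>The squares of these words, for \<open>1 \<le> i < j < n\<close>, are the relators of
  \<open>Wplus n\<close>. The word is empty for \<open>j < i\<close>.\<close>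

definition upt_word :: "nat \<Rightarrow> nat \<Rightarrow> nat word" where
  "upt_word i j = map (\<lambda>k. (k, True)) [i..<Suc j]"

lemma upt_word_words: "{i..j} \<subseteq> X \<Longrightarrow> upt_word i j \<in> words X"
  by (auto simp: upt_word_def words_def subset_iff)

lemma word_eval_upt_word_Suc:
  assumes "group G" and s: "s \<in> X \<rightarrow> carrier G" and "{i..Suc j} \<subseteq> X" "i \<le> Suc j"
  shows "word_eval G s (upt_word i (Suc j)) = word_eval G s (upt_word i j) \<otimes>\<^bsub>G\<^esub> s (Suc j)"
proof -
  interpret group G by fact
  have X: "Suc j \<in> X" "{i..j} \<subseteq> X" using assms(3,4) by auto
  then have "s (Suc j) \<in> carrier G" using s by auto
  moreover have "upt_word i (Suc j) = upt_word i j @ [(Suc j, True)]"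
    using assms(4) by (simp add: upt_word_def)
  moreover have "word_eval G s (upt_word i j @ [(Suc j, True)])
      = word_eval G s (upt_word i j) \<otimes>\<^bsub>G\<^esub> word_eval G s [(Suc j, True)]"
    by (rule word_eval_append[OF s upt_word_words]) (use X in \<open>auto simp: words_def\<close>)
  ultimately show ?thesis by (simp add: word_eval_def)
qed

lemma word_eval_upt_word_Cons:
  "i \<le> j \<Longrightarrow> word_eval G s (upt_word i j) = s i \<otimes>\<^bsub>G\<^esub> word_eval G s (upt_word (Suc i) j)"
  unfolding upt_word_def by (subst upt_conv_Cons) (auto simp: word_eval_def)

lemma word_eval_upt_word_same:
  assumes "group G" "s i \<in> carrier G"
  shows "word_eval G s (upt_word i i) = s i"
  using assms by (simp add: upt_word_def word_eval_def group.is_monoid)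

lemma word_eval_cong:
  "(\<And>x b. (x, b) \<in> set w \<Longrightarrow> s x = t x) \<Longrightarrow> word_eval G s w = word_eval G t w"
  unfolding word_eval_def by (rule foldr_cong) auto

lemma group_Wplus: "group (Wplus n)"
  by (simp add: Wplus_def group_presented_group)

lemma Wplus_gen_closed: "i \<in> {1..<n} \<Longrightarrow> Wplus_gen n i \<in> carrier (Wplus n)"
  by (auto simp: Wplus_def Wplus_gen_def carrier_presented_group words_def)

lemma Wplus_relatorsE:
  assumes "r \<in> Wplus_relators n"
  obtains i j where "1 \<le> i" "i < j" "j < n"
    "r = upt_word i j @ upt_word i j"
  using assms by (fastforce simp: Wplus_relators_def upt_word_def numeral_2_eq_2)

text \<open>This is the condition under which \<open>pres_hom G s\<close> is a homomorphism on
  \<open>Wplus n\<close>. It is stated for evaluated half-relators, so that it can be checked by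
  computing in \<open>G\<close>.\<close>

definition Wplus_images :: "nat \<Rightarrow> ('g, 'y) monoid_scheme \<Rightarrow> (nat \<Rightarrow> 'g) \<Rightarrow> bool" where
  "Wplus_images n G s \<longleftrightarrow> s \<in> {1..<n} \<rightarrow> carrier G \<and>
     (\<forall>i j. 1 \<le> i \<and> i < j \<and> j < n \<longrightarrow>
       word_eval G s (upt_word i j) \<otimes>\<^bsub>G\<^esub>
       word_eval G s (upt_word i j) = \<one>\<^bsub>G\<^esub>)"

context
  fixes n :: nat and G :: "('g, 'y) monoid_scheme" and s :: "nat \<Rightarrow> 'g"
  assumes G: "group G" and img: "Wplus_images n G s"
begin

lemma Wplus_images_closed: "s \<in> {1..<n} \<rightarrow> carrier G"
  using img by (simp add: Wplus_images_def)

lemma word_eval_relator: "r \<in> Wplus_relators n \<Longrightarrow> word_eval G s r = \<one>\<^bsub>G\<^esub>"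
  using img unfolding Wplus_images_def
  by (elim Wplus_relatorsE)
    (auto simp: group.word_eval_append[OF G Wplus_images_closed] upt_word_words subset_iff)

lemma pres_hom_Wplus: "pres_hom G s \<in> hom (Wplus n) G"
  unfolding Wplus_def by (rule group.pres_hom_hom[OF G Wplus_images_closed word_eval_relator])

lemma pres_hom_Wplus_gen: "i \<in> {1..<n} \<Longrightarrow> pres_hom G s (Wplus_gen n i) = s i"
  unfolding Wplus_gen_def by (rule group.pres_hom_generator[OF G Wplus_images_closed word_eval_relator])

lemma pres_hom_Wplus_class:
  "w \<in> words {1..<n} \<Longrightarrow> pres_hom G s (pres_rel {1..<n} (Wplus_relators n) `` {w}) = word_eval G s w"
  by (rule group.pres_hom_class[OF G Wplus_images_closed word_eval_relator])

lemma group_hom_pres_hom: "group_hom (Wplus n) G (pres_hom G s)"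
  using G pres_hom_Wplus group_Wplus by (simp add: group_hom_def group_hom_axioms_def)

end

lemma Wplus_hom_eqI:
  assumes "group H" "g \<in> hom (Wplus n) H" "h \<in> hom (Wplus n) H"
    and "\<And>i. i \<in> {1..<n} \<Longrightarrow> g (Wplus_gen n i) = h (Wplus_gen n i)" and "w \<in> carrier (Wplus n)"
  shows "g w = h w"
  using assms presented_hom_eqI[of H g "{1..<n}" "Wplus_relators n" h w]
  by (simp add: Wplus_def Wplus_gen_def)

lemma Wplus_images_Wplus_gen: "Wplus_images n (Wplus n) (Wplus_gen n)"
  unfolding Wplus_images_def
proof (intro conjI allI impI)
  show "Wplus_gen n \<in> {1..<n} \<rightarrow> carrier (Wplus n)" using Wplus_gen_closed by blast
  fix i j assume ij: "1 \<le> i \<and> i < j \<and> j < n"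
  let ?w = "upt_word i j" and ?c = "\<lambda>w. pres_rel {1..<n} (Wplus_relators n) `` {w}"
  have w: "?w \<in> words {1..<n}" using ij by (intro upt_word_words) auto
  \<comment> \<open>Through the identity map, evaluating a word at the generators yields the class
    of that word.\<close>
  have id: "(\<lambda>x. x) \<in> hom (presented_group {1..<n} (Wplus_relators n)) (Wplus n)"
    by (simp add: Wplus_def hom_def)
  have ev: "word_eval (Wplus n) (Wplus_gen n) ?w = ?c ?w"
    using presented_hom_class[OF group_Wplus id w] by (simp add: Wplus_gen_def[abs_def])
  have "?w @ ?w \<in> Wplus_relators n"
    unfolding Wplus_relators_def using ij by (intro CollectI exI[of _ i] exI[of _ j]) (auto simp: numeral_2_eq_2 upt_word_def)
  then have "([] @ (?w @ ?w) @ [], [] @ []) \<in> pres_rel {1..<n} (Wplus_relators n)"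
    by (intro pres_rel.relator) (use w in \<open>auto simp: words_def\<close>)
  then have "?c (?w @ ?w) = ?c []"
    by (simp add: equiv_class_eq[OF equiv_pres_rel])
  then show "word_eval (Wplus n) (Wplus_gen n) ?w \<otimes>\<^bsub>Wplus n\<^esub> word_eval (Wplus n) (Wplus_gen n) ?w
      = \<one>\<^bsub>Wplus n\<^esub>"
    unfolding ev using presented_mult[OF w w] by (simp add: Wplus_def presented_group_def)
qed

section \<open>The involutory automorphism \<open>conj_aut\<close> of \<open>Wplus n\<close>\<close>

definition conj_gen :: "nat \<Rightarrow> nat \<Rightarrow> nat word set" where
  "conj_gen n j = (if j = 1 then inv\<^bsub>Wplus n\<^esub> Wplus_gen n 1
     else if j = 2 then Wplus_gen n 1 [^]\<^bsub>Wplus n\<^esub> (2::nat) \<otimes>\<^bsub>Wplus n\<^esub> Wplus_gen n 2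
     else Wplus_gen n j)"

lemma conj_aut_eq: "conj_aut n = pres_hom (Wplus n) (conj_gen n)"
  by (simp add: conj_aut_def conj_gen_def[abs_def])

text \<open>The two relations give a y = y a^-1, so a a y = a y a^-1 is a conjugate of the
  involutory \<open>y\<close>. It is applied to the generator 1 as \<open>a\<close> and the product
  of the generators 2 to \<open>j\<close> as \<open>y\<close>.\<close>

lemma (in group) square_mult_eq_one:
  assumes a: "a \<in> carrier G" "y \<in> carrier G" and y: "y \<otimes> y = \<one>" and x: "(a \<otimes> y) \<otimes> (a \<otimes> y) = \<one>"
  shows "(a \<otimes> a \<otimes> y) \<otimes> (a \<otimes> a \<otimes> y) = \<one>"
proof -
  have yi: "inv y = y" using y a by (simp add: inv_equality)
  have "inv (a \<otimes> y) = a \<otimes> y" using x a by (simp add: inv_equality)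
  then have "a \<otimes> y = y \<otimes> inv a" using a yi by (simp add: inv_mult_group)
  then have "a \<otimes> a \<otimes> y = a \<otimes> (y \<otimes> inv a)" using m_assoc[of a a y] a by metis
  then have e: "a \<otimes> a \<otimes> y = a \<otimes> y \<otimes> inv a" using m_assoc[of a y "inv a"] a inv_closed by metis
  have "(a \<otimes> y \<otimes> inv a) \<otimes> (a \<otimes> y \<otimes> inv a) = a \<otimes> (y \<otimes> (inv a \<otimes> (a \<otimes> (y \<otimes> inv a))))"
    using a by (simp add: m_assoc)
  also have "inv a \<otimes> (a \<otimes> (y \<otimes> inv a)) = y \<otimes> inv a"
    using a by (simp add: m_assoc[symmetric])
  also have "a \<otimes> (y \<otimes> (y \<otimes> inv a)) = \<one>"
    using a y by (simp add: m_assoc[symmetric, of y y])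
  finally show ?thesis using e by simp
qed

text \<open>The product of the generators \<open>i\<close> to \<open>j\<close> is unchanged for
  \<open>i = 1\<close>, where the inverse of the first generator cancels against its square, and for
  \<open>i \<ge> 3\<close>; for \<open>i = 2\<close> it is replaced by a conjugate.\<close>

lemma Wplus_images_conj_gen: "Wplus_images n (Wplus n) (conj_gen n)"
proof -
  interpret W: group "Wplus n" by (rule group_Wplus)
  let ?W = "Wplus n" and ?g = "Wplus_gen n"
  let ?u = upt_word
  let ?e = "\<lambda>i j. word_eval ?W ?g (?u i j)"
  have gens: "?g \<in> {1..<n} \<rightarrow> carrier ?W" by (rule Wplus_images_closed[OF group_Wplus Wplus_images_Wplus_gen])
  have sq: "?e i j \<otimes>\<^bsub>?W\<^esub> ?e i j = \<one>\<^bsub>?W\<^esub>" if "1 \<le> i" "i < j" "j < n" for i j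
    using Wplus_images_Wplus_gen that unfolding Wplus_images_def by blast
  have ecl: "?e i j \<in> carrier ?W" if "1 \<le> i" "j < n" for i j
    by (rule W.word_eval_closed[OF gens upt_word_words]) (use that in auto)
  have cl: "conj_gen n \<in> {1..<n} \<rightarrow> carrier ?W"
    using Wplus_gen_closed[of _ n] by (auto simp: conj_gen_def)
  have e3: "word_eval ?W (conj_gen n) (?u i j) = ?e i j" if "3 \<le> i" for i j
    by (rule word_eval_cong) (use that in \<open>auto simp: conj_gen_def upt_word_def split: if_splits\<close>)
  show ?thesis
    unfolding Wplus_images_def
  proof (intro conjI allI impI)
    fix i j assume ij: "1 \<le> i \<and> i < j \<and> j < n"
    have g1: "?g 1 \<in> carrier ?W" and g2: "?g 2 \<in> carrier ?W"
      using ij by (auto intro!: Wplus_gen_closed)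
    \<comment> \<open>The value \<open>j = 2\<close> is included because the relator with
      \<open>i = 1\<close> and \<open>j = 2\<close> needs it.\<close>
    have e2: "word_eval ?W (conj_gen n) (?u 2 j) = ?g 1 \<otimes>\<^bsub>?W\<^esub> ?g 1 \<otimes>\<^bsub>?W\<^esub> ?e 2 j" if j: "2 \<le> j"
    proof (cases "j = 2")
      case True
      then show ?thesis using g1 g2
        by (simp add: word_eval_upt_word_same[OF group_Wplus] conj_gen_def numeral_2_eq_2 W.m_assoc)
    next
      case False
      have "word_eval ?W (conj_gen n) (?u 2 j) = conj_gen n 2 \<otimes>\<^bsub>?W\<^esub> word_eval ?W (conj_gen n) (?u 3 j)"
        using word_eval_upt_word_Cons[OF j] by (simp add: eval_nat_numeral)
      moreover have "?e 2 j = ?g 2 \<otimes>\<^bsub>?W\<^esub> ?e 3 j"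
        using word_eval_upt_word_Cons[OF j] by (simp add: eval_nat_numeral)
      ultimately show ?thesis using g1 g2 ecl[of 3 j] ij e3[of 3 j]
        by (simp add: conj_gen_def numeral_2_eq_2 W.m_assoc)
    qed
    consider "i = 1" | "i = 2" | "3 \<le> i" using ij by linarith
    then show "word_eval ?W (conj_gen n) (?u i j) \<otimes>\<^bsub>?W\<^esub> word_eval ?W (conj_gen n) (?u i j) = \<one>\<^bsub>?W\<^esub>"
    proof cases
      case 1
      have "word_eval ?W (conj_gen n) (?u 1 j) = conj_gen n 1 \<otimes>\<^bsub>?W\<^esub> word_eval ?W (conj_gen n) (?u 2 j)"
        using word_eval_upt_word_Cons[of 1 j ?W] ij 1 by (simp add: eval_nat_numeral)
      also have "\<dots> = ?g 1 \<otimes>\<^bsub>?W\<^esub> ?e 2 j"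
        using e2 ij 1 g1 ecl[of 2 j]
        by (simp add: conj_gen_def W.m_assoc) (simp add: W.m_assoc[symmetric])
      also have "\<dots> = ?e 1 j"
        using word_eval_upt_word_Cons[of 1 j ?W] ij 1 by (simp add: eval_nat_numeral)
      finally show ?thesis using sq[of 1 j] 1 ij by simp
    next
      case 2
      have "?e 1 j = ?g 1 \<otimes>\<^bsub>?W\<^esub> ?e 2 j"
        using word_eval_upt_word_Cons[of 1 j ?W] ij 2 by (simp add: eval_nat_numeral)
      then show ?thesis
        using W.square_mult_eq_one[OF g1 ecl[of 2 j]] sq[of 1 j] sq[of 2 j] e2 2 ij by simp
    next
      case 3
      then show ?thesis using e3 sq ij by simp
    qed
  qed (rule cl)
qed

lemmas conj_aut_hom = pres_hom_Wplus[OF group_Wplus Wplus_images_conj_gen, folded conj_aut_eq]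

lemmas conj_aut_gen = pres_hom_Wplus_gen[OF group_Wplus Wplus_images_conj_gen, folded conj_aut_eq]

lemma conj_aut_closed: "w \<in> carrier (Wplus n) \<Longrightarrow> conj_aut n w \<in> carrier (Wplus n)"
  using conj_aut_hom by (auto simp: hom_def)

text \<open>On generators: the second goes to s1^2 s2 and then to s1^-2 s1^2 s2 = s2. Being its own
  inverse makes \<open>conj_aut n\<close> bijective, so it preserves normality.\<close>

lemma conj_aut_conj_aut:
  assumes "w \<in> carrier (Wplus n)"
  shows "conj_aut n (conj_aut n w) = w"
proof -
  interpret W: group "Wplus n" by (rule group_Wplus)
  interpret h: group_hom "Wplus n" "Wplus n" "conj_aut n"
    using conj_aut_hom by unfold_locales
  have comp: "conj_aut n \<circ> conj_aut n \<in> hom (Wplus n) (Wplus n)"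
    using conj_aut_hom by (rule hom_compose[OF conj_aut_hom])
  have id: "(\<lambda>x. x) \<in> hom (Wplus n) (Wplus n)" by (simp add: hom_def)
  have "(conj_aut n \<circ> conj_aut n) w = w"
  proof (rule Wplus_hom_eqI[OF group_Wplus comp id _ assms])
    fix i assume i: "i \<in> {1..<n}"
    let ?g = "Wplus_gen n"
    have g1: "?g 1 \<in> carrier (Wplus n)" using i by (auto intro: Wplus_gen_closed)
    have c1: "conj_aut n (?g 1) = inv\<^bsub>Wplus n\<^esub> ?g 1"
      using conj_aut_gen[of 1 n] i by (simp add: conj_gen_def)
    consider "i = 1" | "i = 2" | "i \<noteq> 1" "i \<noteq> 2" by blast
    then show "(conj_aut n \<circ> conj_aut n) (?g i) = ?g i"
    proof cases
      case 1
      then show ?thesis using c1 g1 by simp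
    next
      case 2
      then have g2: "?g 2 \<in> carrier (Wplus n)" using i by (auto intro: Wplus_gen_closed)
      have "conj_aut n (?g 2) = ?g 1 \<otimes>\<^bsub>Wplus n\<^esub> ?g 1 \<otimes>\<^bsub>Wplus n\<^esub> ?g 2"
        using conj_aut_gen[of 2 n] i 2 g1 by (simp add: conj_gen_def numeral_2_eq_2)
      then show ?thesis using 2 g1 g2 c1
        by (simp add: W.m_assoc) (simp add: W.m_assoc[symmetric])
    next
      case 3
      then show ?thesis using conj_aut_gen[OF i] by (simp add: conj_gen_def)
    qed
  qed
  then show ?thesis by simp
qed

lemma conj_aut_surj: "conj_aut n ` carrier (Wplus n) = carrier (Wplus n)"
  using conj_aut_closed conj_aut_conj_aut by force

lemma conj_aut_normal:
  assumes "M \<lhd> Wplus n"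
  shows "conj_aut n ` M \<lhd> Wplus n"
  by (rule normal.surj_hom_normal_subgroup[OF assms _ conj_aut_surj])
    (simp add: group_hom_def group_hom_axioms_def group_Wplus conj_aut_hom)

text \<open>In rank 2 the group is cyclic on its only generator, and \<open>conj_aut 2\<close>
  inverts that generator.\<close>

lemma conj_aut_rank_2:
  assumes "w \<in> carrier (Wplus 2)"
  shows "conj_aut 2 w = inv\<^bsub>Wplus 2\<^esub> w"
proof -
  interpret W: group "Wplus 2" by (rule group_Wplus)
  let ?g = "Wplus_gen 2 1"
  have g: "?g \<in> carrier (Wplus 2)" by (rule Wplus_gen_closed) simp
  interpret c: group_hom "Wplus 2" "Wplus 2" "conj_aut 2"
    using conj_aut_hom by unfold_locales
  interpret C: subgroup "generate (Wplus 2) {?g}" "Wplus 2"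
    using g by (intro W.generate_is_subgroup) simp
  have X: "{Suc 0..<2} = {Suc 0}" by auto
  have id: "(\<lambda>x. x) \<in> hom (presented_group {1..<2} (Wplus_relators 2)) (Wplus 2)"
    by (simp add: Wplus_def hom_def)
  obtain v where v: "v \<in> words {1..<2}" "w = word_eval (Wplus 2) (Wplus_gen 2) v"
    using assms presented_hom_class[OF group_Wplus id]
    by (auto simp: Wplus_def Wplus_gen_def[abs_def] carrier_presented_group)
  have "word_eval (Wplus 2) (Wplus_gen 2) v \<in> generate (Wplus 2) {?g}"
    using v(1)
  proof (induction v)
    case Nil
    then show ?case by (simp add: word_eval_def generate.one)
  next
    case (Cons l v)
    then show ?case by (cases l) (auto simp: word_eval_def words_def X generate.incl generate.inv generate.eng)
  qed
  then obtain k :: int where k: "w = ?g [^]\<^bsub>Wplus 2\<^esub> k"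
    using W.generate_pow[OF g] v(2) by auto
  have "conj_aut 2 ?g = inv\<^bsub>Wplus 2\<^esub> ?g"
    using conj_aut_gen[of 1 2] by (simp add: conj_gen_def)
  then show ?thesis using k g by (simp add: c.hom_int_pow W.int_pow_inv)
qed

section \<open>Flags and automorphisms of finite polytopes\<close>

locale finite_polytope =
  fixes n :: nat and P :: "'a ranked_poset"
  assumes polytope: "abstract_polytope n P" and finite_faces: "finite (faces P)"
begin

abbreviation le :: "'a \<Rightarrow> 'a \<Rightarrow> bool" where
  "le F G \<equiv> (F, G) \<in> incid P"

abbreviation between :: "'a \<Rightarrow> 'a \<Rightarrow> 'a set" where
  "between F G \<equiv> {H. le F H \<and> le H G \<and> H \<noteq> F \<and> H \<noteq> G}"

abbreviation adj :: "nat \<Rightarrow> 'a set \<Rightarrow> 'a set" where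
  "adj \<equiv> adj_flag P"

text \<open>A flag is handled as a function of the rank, inverse to \<open>rank P\<close> on the
  flag. The values are meaningful for ranks in \<open>{-1..int n}\<close>.\<close>

definition face_at :: "'a set \<Rightarrow> int \<Rightarrow> 'a" where
  "face_at \<Phi> = inv_into \<Phi> (rank P)"

lemma
  shows le_refl: "F \<in> faces P \<Longrightarrow> le F F"
    and le_trans: "le F G \<Longrightarrow> le G H \<Longrightarrow> le F H"
    and rank_less: "le F G \<Longrightarrow> F \<noteq> G \<Longrightarrow> rank P F < rank P G"
    and greatest_face: "\<exists>G \<in> faces P. \<forall>F \<in> faces P. le F G"
    and bij_rank: "\<Phi> \<in> flags P \<Longrightarrow> bij_betw (rank P) \<Phi> {-1..int n}"
    and diamond: "le F G \<Longrightarrow> rank P G = rank P F + 2 \<Longrightarrow> card (between F G) = 2"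
    and flag_connected: "\<Phi> \<in> flags P \<Longrightarrow> \<Psi> \<in> flags P \<Longrightarrow>
      (\<Phi>, \<Psi>) \<in> {(A, B). adjacent P A B \<and> \<Phi> \<inter> \<Psi> \<subseteq> A \<and> \<Phi> \<inter> \<Psi> \<subseteq> B}\<^sup>*"
proof -
  note p = polytope[unfolded abstract_polytope_def]
  show "F \<in> faces P \<Longrightarrow> le F F"
    using p by (simp add: faces_def partial_order_on_def preorder_on_def refl_on_def)
  show "le F G \<Longrightarrow> le G H \<Longrightarrow> le F H"
    using p unfolding partial_order_on_def preorder_on_def by (meson transE)
  show "le F G \<Longrightarrow> F \<noteq> G \<Longrightarrow> rank P F < rank P G" using p by blast
  show "\<exists>G \<in> faces P. \<forall>F \<in> faces P. le F G" using p by blast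
  show "\<Phi> \<in> flags P \<Longrightarrow> bij_betw (rank P) \<Phi> {-1..int n}" using p by blast
  show "le F G \<Longrightarrow> rank P G = rank P F + 2 \<Longrightarrow> card (between F G) = 2" using p by blast
  show "\<Phi> \<in> flags P \<Longrightarrow> \<Psi> \<in> flags P \<Longrightarrow>
      (\<Phi>, \<Psi>) \<in> {(A, B). adjacent P A B \<and> \<Phi> \<inter> \<Psi> \<subseteq> A \<and> \<Phi> \<inter> \<Psi> \<subseteq> B}\<^sup>*"
    using p by blast
qed

lemma le_faces: "le F G \<Longrightarrow> F \<in> faces P \<and> G \<in> faces P"
  by (auto simp: faces_def Field_def)

lemma rank_le: "le F G \<Longrightarrow> rank P F \<le> rank P G"
  using rank_less by (cases "F = G") (auto intro: less_imp_le)

lemma chain_faces: "C \<in> Chains (incid P) \<Longrightarrow> C \<subseteq> faces P"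
  by (auto simp: Chains_def dest: le_faces)

lemma flag_faces: "\<Phi> \<in> flags P \<Longrightarrow> \<Phi> \<subseteq> faces P"
  by (simp add: flags_def chain_faces)

lemma finite_flag: "\<Phi> \<in> flags P \<Longrightarrow> finite \<Phi>"
  using flag_faces finite_faces finite_subset by blast

lemma card_flag: "\<Phi> \<in> flags P \<Longrightarrow> card \<Phi> = n + 2"
  using bij_betw_same_card[OF bij_rank] by simp

text \<open>There are only finitely many chains, so one that is maximal among those containing
  \<open>C\<close> exists.\<close>

lemma chain_extends_to_flag:
  assumes "C \<in> Chains (incid P)"
  obtains \<Phi> where "\<Phi> \<in> flags P" "C \<subseteq> \<Phi>"
proof -
  let ?S = "{D \<in> Chains (incid P). C \<subseteq> D}"
  have "?S \<subseteq> Pow (faces P)" using chain_faces by blast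
  then have "finite ?S" using finite_faces finite_subset by blast
  moreover have "?S \<noteq> {}" using assms by blast
  ultimately have "\<exists>\<Phi> \<in> ?S. \<forall>D \<in> ?S. \<Phi> \<subseteq> D \<longrightarrow> \<Phi> = D" by (rule finite_has_maximal)
  then obtain \<Phi> where \<Phi>: "\<Phi> \<in> ?S" and max: "\<forall>D \<in> ?S. \<Phi> \<subseteq> D \<longrightarrow> \<Phi> = D" by (rule bexE)
  have "\<Phi> \<in> flags P"
    unfolding flags_def
  proof (intro CollectI conjI ballI impI)
    show "\<Phi> \<in> Chains (incid P)" using \<Phi> by simp
    fix D assume D: "D \<in> Chains (incid P)" "\<Phi> \<subseteq> D"
    then have "D \<in> ?S" using \<Phi> by (simp add: subset_trans[of C \<Phi> D])
    then show "D = \<Phi>" using max[rule_format, of D] D(2) by simp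
  qed
  then show thesis using that \<Phi> by simp
qed

text \<open>Every flag has one face for each of the \<open>n + 2\<close> ranks from -1 to
  \<open>n\<close>, so a chain of that size fills any flag containing it.\<close>

lemma flagI:
  assumes "C \<in> Chains (incid P)" "card C = n + 2"
  shows "C \<in> flags P"
proof -
  obtain \<Phi> where \<Phi>: "\<Phi> \<in> flags P" "C \<subseteq> \<Phi>" by (rule chain_extends_to_flag[OF assms(1)])
  then have "C = \<Phi>" using card_subset_eq[OF finite_flag[OF \<Phi>(1)] \<Phi>(2)] card_flag assms(2) by simp
  then show ?thesis using \<Phi>(1) by simp
qed

lemma
  assumes "\<Phi> \<in> flags P"
  shows face_at_in: "k \<in> {-1..int n} \<Longrightarrow> face_at \<Phi> k \<in> \<Phi>"
    and rank_face_at: "k \<in> {-1..int n} \<Longrightarrow> rank P (face_at \<Phi> k) = k"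
    and face_at_rank: "F \<in> \<Phi> \<Longrightarrow> face_at \<Phi> (rank P F) = F"
    and rank_range: "F \<in> \<Phi> \<Longrightarrow> rank P F \<in> {-1..int n}"
proof -
  have img: "rank P ` \<Phi> = {-1..int n}" and inj: "inj_on (rank P) \<Phi>"
    using bij_rank[OF assms] by (auto simp: bij_betw_def)
  show "k \<in> {-1..int n} \<Longrightarrow> face_at \<Phi> k \<in> \<Phi>"
    unfolding face_at_def img[symmetric] by (rule inv_into_into)
  show "k \<in> {-1..int n} \<Longrightarrow> rank P (face_at \<Phi> k) = k"
    unfolding face_at_def img[symmetric] by (rule f_inv_into_f)
  show "F \<in> \<Phi> \<Longrightarrow> face_at \<Phi> (rank P F) = F"
    unfolding face_at_def by (rule inv_into_f_f[OF inj])
  show "F \<in> \<Phi> \<Longrightarrow> rank P F \<in> {-1..int n}"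
    using img by blast
qed

lemma face_at_eqI: "\<Phi> \<in> flags P \<Longrightarrow> F \<in> \<Phi> \<Longrightarrow> rank P F = k \<Longrightarrow> face_at \<Phi> k = F"
  using face_at_rank by blast

lemma flag_le:
  assumes "\<Phi> \<in> flags P" "F \<in> \<Phi>" "G \<in> \<Phi>" "rank P F \<le> rank P G"
  shows "le F G"
proof -
  have "le F G \<or> le G F" using assms(1-3) by (simp add: flags_def Chains_def)
  then show ?thesis using rank_less[of G F] assms(4) by (cases "F = G") auto
qed

lemma flag_eqI:
  assumes "\<Phi> \<in> flags P" "\<Psi> \<in> flags P" "\<And>k. k \<in> {-1..int n} \<Longrightarrow> face_at \<Phi> k = face_at \<Psi> k"
  shows "\<Phi> = \<Psi>"
proof -
  have "\<Phi> = face_at \<Phi> ` {-1..int n}" if "\<Phi> \<in> flags P" for \<Phi>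
    using face_at_in[OF that] face_at_rank[OF that] rank_range[OF that] by force
  then show ?thesis using assms by (metis image_cong)
qed

section \<open>Adjacent flags: existence, uniqueness and commutation\<close>

lemma i_adjacent_iff:
  assumes "\<Phi> \<in> flags P" "\<Psi> \<in> flags P"
  shows "i_adjacent P i \<Phi> \<Psi> \<longleftrightarrow>
    \<Phi> \<noteq> \<Psi> \<and> (\<forall>k \<in> {-1..int n}. k \<noteq> int i \<longrightarrow> face_at \<Psi> k = face_at \<Phi> k)"
proof -
  have sub: "{F \<in> A. rank P F \<noteq> int i} \<subseteq> {F \<in> B. rank P F \<noteq> int i}"
    if A: "A \<in> flags P" and B: "B \<in> flags P"
      and eq: "\<forall>k \<in> {-1..int n}. k \<noteq> int i \<longrightarrow> face_at B k = face_at A k" for A B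
    using face_at_rank[OF A] rank_range[OF A] face_at_in[OF B] eq by fastforce
  have "face_at \<Psi> k = face_at \<Phi> k"
    if eq: "{F \<in> \<Phi>. rank P F \<noteq> int i} = {F \<in> \<Psi>. rank P F \<noteq> int i}" and k: "k \<in> {-1..int n}" "k \<noteq> int i" for k
  proof (rule face_at_eqI[OF assms(2) _ rank_face_at[OF assms(1) k(1)]])
    have "face_at \<Phi> k \<in> {F \<in> \<Phi>. rank P F \<noteq> int i}"
      using face_at_in[OF assms(1)] rank_face_at[OF assms(1)] k by auto
    then show "face_at \<Phi> k \<in> \<Psi>" using eq by blast
  qed
  moreover have "{F \<in> \<Phi>. rank P F \<noteq> int i} = {F \<in> \<Psi>. rank P F \<noteq> int i}"
    if "\<forall>k \<in> {-1..int n}. k \<noteq> int i \<longrightarrow> face_at \<Psi> k = face_at \<Phi> k"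
    using sub[OF assms] sub[OF assms(2,1)] that by (intro equalityI) auto
  ultimately show ?thesis using assms unfolding i_adjacent_def by blast
qed

lemma i_adjacent_sym: "i_adjacent P i \<Phi> \<Psi> \<Longrightarrow> i_adjacent P i \<Psi> \<Phi>"
  by (auto simp: i_adjacent_def)

lemma i_adjacent_flags: "i_adjacent P i \<Phi> \<Psi> \<Longrightarrow> \<Phi> \<in> flags P \<and> \<Psi> \<in> flags P"
  by (simp add: i_adjacent_def)

lemma i_adjacent_face_at:
  "i_adjacent P i \<Phi> \<Psi> \<Longrightarrow> k \<in> {-1..int n} \<Longrightarrow> k \<noteq> int i \<Longrightarrow> face_at \<Psi> k = face_at \<Phi> k"
  using i_adjacent_iff i_adjacent_flags by blast

lemma i_adjacent_face_at_neq:
  assumes "i_adjacent P i \<Phi> \<Psi>"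
  shows "face_at \<Psi> (int i) \<noteq> face_at \<Phi> (int i)"
proof
  assume "face_at \<Psi> (int i) = face_at \<Phi> (int i)"
  then have "\<Psi> = \<Phi>"
    using i_adjacent_face_at[OF assms] i_adjacent_flags[OF assms] by (intro flag_eqI) metis+
  then show False using assms by (simp add: i_adjacent_def)
qed

lemma face_at_between:
  assumes "\<Phi> \<in> flags P" "i < n"
  shows "face_at \<Phi> (int i) \<in> between (face_at \<Phi> (int i - 1)) (face_at \<Phi> (int i + 1))" (is ?B)
    and "card (between (face_at \<Phi> (int i - 1)) (face_at \<Phi> (int i + 1))) = 2" (is ?C)
proof -
  have k: "int i \<in> {-1..int n}" "int i - 1 \<in> {-1..int n}" "int i + 1 \<in> {-1..int n}"
    using assms(2) by auto
  note r = k[THEN rank_face_at[OF assms(1)]] and m = k[THEN face_at_in[OF assms(1)]]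
  have "face_at \<Phi> (int i) \<noteq> face_at \<Phi> (int i - 1)" "face_at \<Phi> (int i) \<noteq> face_at \<Phi> (int i + 1)"
    using r by (metis add_cancel_left_right diff_add_cancel zero_neq_one)+
  then show ?B using r m flag_le[OF assms(1)] by auto
  show ?C by (rule diamond) (use r m flag_le[OF assms(1)] in auto)
qed

text \<open>By the diamond condition, the \<open>i\<close>-face of an \<open>i\<close>-adjacent flag depends only on the faces of
  ranks \<open>i - 1\<close>, \<open>i\<close> and \<open>i + 1\<close>. This yields both the uniqueness of \<open>i\<close>-adjacent flags and the
  commutation of non-neighbouring adjacencies.\<close>
lemma i_adjacent_face_at_cong:
  assumes "i_adjacent P i \<Phi> \<Psi>" "i_adjacent P i \<Phi>' \<Psi>'" "i < n"
    and eq: "\<And>k. k \<in> {int i - 1, int i, int i + 1} \<Longrightarrow> face_at \<Phi>' k = face_at \<Phi> k"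
  shows "face_at \<Psi>' (int i) = face_at \<Psi> (int i)"
proof -
  let ?B = "between (face_at \<Phi> (int i - 1)) (face_at \<Phi> (int i + 1))"
  have fl: "\<Phi> \<in> flags P" "\<Psi> \<in> flags P" "\<Phi>' \<in> flags P" "\<Psi>' \<in> flags P"
    using assms(1,2) i_adjacent_flags by auto
  have k: "int i - 1 \<in> {-1..int n}" "int i + 1 \<in> {-1..int n}" using assms(3) by auto
  have "face_at \<Phi> (int i) \<in> ?B" by (rule face_at_between(1)[OF fl(1) assms(3)])
  moreover have "face_at \<Psi> (int i) \<in> ?B"
    using face_at_between(1)[OF fl(2) assms(3)] k[THEN i_adjacent_face_at[OF assms(1)]] by simp
  moreover have "face_at \<Psi>' (int i) \<in> ?B"
    using face_at_between(1)[OF fl(4) assms(3)] k[THEN i_adjacent_face_at[OF assms(2)]] eq by simp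
  moreover have "face_at \<Psi> (int i) \<noteq> face_at \<Phi> (int i)" "face_at \<Psi>' (int i) \<noteq> face_at \<Phi> (int i)"
    using i_adjacent_face_at_neq[OF assms(1)] i_adjacent_face_at_neq[OF assms(2)] eq by auto
  moreover obtain a b where "?B = {a, b}"
    using face_at_between(2)[OF fl(1) assms(3)] by (auto simp: card_2_iff)
  ultimately show ?thesis by (metis insert_iff singletonD)
qed

lemma i_adjacent_unique:
  assumes "i_adjacent P i \<Phi> \<Psi>" "i_adjacent P i \<Phi> \<Psi>'" "i < n"
  shows "\<Psi>' = \<Psi>"
proof (rule flag_eqI)
  fix k assume "k \<in> {-1..int n}"
  then show "face_at \<Psi>' k = face_at \<Psi> k"
    using i_adjacent_face_at[OF assms(1)] i_adjacent_face_at[OF assms(2)]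
      i_adjacent_face_at_cong[OF assms] by (cases "k = int i") auto
qed (use assms i_adjacent_flags in auto)

text \<open>The diamond condition supplies a second face between the neighbours of the
  \<open>i\<close>-face; exchanging the two gives the new flag.\<close>

lemma i_adjacent_exists:
  assumes \<Phi>: "\<Phi> \<in> flags P" and i: "i < n"
  shows "\<exists>\<Psi>. i_adjacent P i \<Phi> \<Psi>"
proof -
  let ?F = "face_at \<Phi> (int i)" and ?L = "face_at \<Phi> (int i - 1)" and ?U = "face_at \<Phi> (int i + 1)"
  have k: "int i \<in> {-1..int n}" "int i - 1 \<in> {-1..int n}" "int i + 1 \<in> {-1..int n}"
    using i by auto
  note r = k[THEN rank_face_at[OF \<Phi>]] and m = k[THEN face_at_in[OF \<Phi>]]
  obtain H where H: "H \<in> between ?L ?U" "H \<noteq> ?F"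
    using face_at_between[OF \<Phi> i] by (auto simp: card_2_iff)
  have rH: "rank P H = int i" using H(1) rank_less[of ?L H] rank_less[of H ?U] r by auto
  have HF: "H \<notin> \<Phi>" using face_at_eqI[OF \<Phi> _ rH] H(2) by blast
  let ?\<Psi> = "insert H (\<Phi> - {?F})"
  \<comment> \<open>Each remaining face lies below \<open>?L\<close> or above \<open>?U\<close>, and
    hence is comparable with \<open>H\<close> by transitivity.\<close>
  have cmp: "le G H \<or> le H G" if "G \<in> \<Phi>" "G \<noteq> ?F" for G
  proof -
    have "rank P G \<noteq> int i" using face_at_eqI[OF \<Phi> that(1)] that(2) by blast
    then consider "rank P G \<le> int i - 1" | "int i + 1 \<le> rank P G" by linarith
    then show ?thesis
    proof cases
      case 1
      then have "le G ?L" using flag_le[OF \<Phi> that(1) m(2)] r by simp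
      then show ?thesis using H(1) le_trans by blast
    next
      case 2
      then have "le ?U G" using flag_le[OF \<Phi> m(3) that(1)] r by simp
      then show ?thesis using H(1) le_trans by blast
    qed
  qed
  have "le H H" using H(1) le_refl le_faces by blast
  moreover have "\<forall>a \<in> \<Phi>. \<forall>b \<in> \<Phi>. le a b \<or> le b a" using \<Phi> by (auto simp: flags_def Chains_def)
  ultimately have "?\<Psi> \<in> Chains (incid P)" using cmp unfolding Chains_def by blast
  moreover have "card ?\<Psi> = n + 2"
    using card_flag[OF \<Phi>] finite_flag[OF \<Phi>] HF m(1) by (simp add: card_insert_if card_Diff_singleton)
  ultimately have "?\<Psi> \<in> flags P" by (rule flagI)
  moreover have "\<Phi> \<noteq> ?\<Psi>" using HF by blast
  moreover have "{G \<in> \<Phi>. rank P G \<noteq> int i} = {G \<in> ?\<Psi>. rank P G \<noteq> int i}" using rH r(1) by auto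
  ultimately show ?thesis using \<Phi> unfolding i_adjacent_def by blast
qed

lemma i_adjacent_adj:
  assumes "\<Phi> \<in> flags P" "i < n"
  shows "i_adjacent P i \<Phi> (adj i \<Phi>)"
  unfolding adj_flag_def
proof (rule theI')
  obtain \<Psi> where "i_adjacent P i \<Phi> \<Psi>" using i_adjacent_exists[OF assms] by blast
  then show "\<exists>!\<Psi>. i_adjacent P i \<Phi> \<Psi>"
    using i_adjacent_unique[OF _ _ assms(2)] by (intro ex1I[of _ \<Psi>])
qed

lemma adj_eqI: "i_adjacent P i \<Phi> \<Psi> \<Longrightarrow> i < n \<Longrightarrow> adj i \<Phi> = \<Psi>"
  using i_adjacent_unique[OF _ i_adjacent_adj] i_adjacent_flags by simp

lemma adj_flag: "\<Phi> \<in> flags P \<Longrightarrow> i < n \<Longrightarrow> adj i \<Phi> \<in> flags P"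
  using i_adjacent_flags[OF i_adjacent_adj] by simp

lemma adj_adj: "\<Phi> \<in> flags P \<Longrightarrow> i < n \<Longrightarrow> adj i (adj i \<Phi>) = \<Phi>"
  by (rule adj_eqI[OF i_adjacent_sym[OF i_adjacent_adj]])

lemma face_at_adj:
  "\<Phi> \<in> flags P \<Longrightarrow> i < n \<Longrightarrow> k \<in> {-1..int n} \<Longrightarrow> k \<noteq> int i \<Longrightarrow> face_at (adj i \<Phi>) k = face_at \<Phi> k"
  by (rule i_adjacent_face_at[OF i_adjacent_adj])

lemma adj_distinct:
  assumes "\<Phi> \<in> flags P" "i < n" "j < n" "i \<noteq> j"
  shows "adj i \<Phi> \<noteq> adj j \<Phi>"
  using i_adjacent_face_at_neq[OF i_adjacent_adj[OF assms(1,2)]]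
    face_at_adj[OF assms(1,3), of "int i"] assms by auto

lemma adj_commute:
  assumes \<Phi>: "\<Phi> \<in> flags P" and i: "i < n" and j: "j < n" and d: "i + 2 \<le> j \<or> j + 2 \<le> i"
  shows "adj i (adj j \<Phi>) = adj j (adj i \<Phi>)"
proof (rule flag_eqI)
  \<comment> \<open>With \<open>a\<close> and \<open>b\<close> at least 2 apart, passing to the
    \<open>b\<close>-adjacent flag leaves ranks \<open>a - 1\<close>, \<open>a\<close> and
    \<open>a + 1\<close> alone, and these determine the new \<open>a\<close>-face.\<close>
  have new: "face_at (adj a (adj b \<Phi>)) (int a) = face_at (adj a \<Phi>) (int a)"
    if "a < n" "b < n" "a + 2 \<le> b \<or> b + 2 \<le> a" for a b
    by (rule i_adjacent_face_at_cong[OF i_adjacent_adj[OF \<Phi> that(1)] i_adjacent_adj[OF adj_flag[OF \<Phi> that(2)] that(1)]])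
      (use that face_at_adj[OF \<Phi> that(2)] in auto)
  fix k assume k: "k \<in> {-1..int n}"
  consider "k = int i" | "k = int j" | "k \<noteq> int i" "k \<noteq> int j" by blast
  then show "face_at (adj i (adj j \<Phi>)) k = face_at (adj j (adj i \<Phi>)) k"
  proof cases
    case 1
    then show ?thesis
      using new[OF i j d] face_at_adj[OF adj_flag[OF \<Phi> i] j k] d by auto
  next
    case 2
    then show ?thesis
      using new[OF j i] face_at_adj[OF adj_flag[OF \<Phi> j] i k] d by auto
  next
    case 3
    then show ?thesis using face_at_adj[OF _ i k] face_at_adj[OF _ j k] adj_flag \<Phi> i j by auto
  qed
qed (use adj_flag \<Phi> i j in auto)

text \<open>\<open>i_adjacent\<close> admits every natural index. For \<open>i \<ge> n\<close> no
  face could change: the face of rank \<open>n\<close> is the greatest face in every flag, and flags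
  have no faces of larger rank.\<close>

lemma i_adjacent_less:
  assumes "i_adjacent P i \<Phi> \<Psi>"
  shows "i < n"
proof (rule ccontr)
  assume i: "\<not> i < n"
  obtain T where T: "T \<in> faces P" "\<And>F. F \<in> faces P \<Longrightarrow> le F T" using greatest_face by blast
  have top: "face_at A (int n) = T" if A: "A \<in> flags P" for A
  proof (rule face_at_eqI[OF A])
    have "insert T A \<in> Chains (incid P)"
      using A T flag_faces[OF A] unfolding flags_def Chains_def by blast
    then show TA: "T \<in> A" using A unfolding flags_def by blast
    have "face_at A (int n) \<in> faces P" using face_at_in[OF A, of "int n"] flag_faces[OF A] by auto
    then have "le (face_at A (int n)) T" by (rule T(2))
    then show "rank P T = int n"
      using rank_le rank_face_at[OF A, of "int n"] rank_range[OF A TA] by fastforce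
  qed
  have fl: "\<Phi> \<in> flags P" "\<Psi> \<in> flags P" using assms i_adjacent_flags by auto
  have "\<Psi> = \<Phi>"
  proof (rule flag_eqI[OF fl(2,1)])
    fix k assume k: "k \<in> {-1..int n}"
    show "face_at \<Psi> k = face_at \<Phi> k"
      using i_adjacent_face_at[OF assms k] top fl k i by (cases "k = int n") auto
  qed
  then show False using assms by (simp add: i_adjacent_def)
qed

section \<open>The automorphism group and its free action on flags\<close>

abbreviation Aut :: "('a \<Rightarrow> 'a) monoid" where
  "Aut \<equiv> aut_group P"

lemma Aut_carrier:
  "f \<in> carrier Aut \<longleftrightarrow> f \<in> Bij (faces P) \<and> (\<forall>F \<in> faces P. \<forall>G \<in> faces P. le (f F) (f G) \<longleftrightarrow> le F G)"
  by (simp add: aut_group_def)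

lemma Aut_mult: "f \<in> carrier Aut \<Longrightarrow> g \<in> carrier Aut \<Longrightarrow> f \<otimes>\<^bsub>Aut\<^esub> g = compose (faces P) f g"
  by (simp add: aut_group_def BijGroup_def)

lemma Aut_one: "\<one>\<^bsub>Aut\<^esub> = (\<lambda>x \<in> faces P. x)"
  by (simp add: aut_group_def BijGroup_def)

lemma Aut_inj: "f \<in> carrier Aut \<Longrightarrow> inj_on f (faces P)"
  by (simp add: Aut_carrier Bij_def bij_betw_def)

lemma Aut_le: "f \<in> carrier Aut \<Longrightarrow> F \<in> faces P \<Longrightarrow> G \<in> faces P \<Longrightarrow> le (f F) (f G) \<longleftrightarrow> le F G"
  by (simp add: Aut_carrier)

lemma group_Aut: "group Aut"
proof -
  interpret B: group "BijGroup (faces P)" by (rule group_BijGroup)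
  let ?A = "{f \<in> Bij (faces P). \<forall>F \<in> faces P. \<forall>G \<in> faces P. le (f F) (f G) \<longleftrightarrow> le F G}"
  have "subgroup ?A (BijGroup (faces P))"
  proof (rule B.subgroupI)
    show "?A \<subseteq> carrier (BijGroup (faces P))" by (auto simp: BijGroup_def)
    have "(\<lambda>x \<in> faces P. x) \<in> ?A" by (simp add: id_Bij)
    then show "?A \<noteq> {}" by blast
    fix f assume f: "f \<in> ?A"
    then have fB: "f \<in> Bij (faces P)" by blast
    have "le (inv_into (faces P) f F) (inv_into (faces P) f G) \<longleftrightarrow> le F G"
      if "F \<in> faces P" "G \<in> faces P" for F G
    proof -
      have img: "f ` faces P = faces P" using fB by (simp add: Bij_def bij_betw_def)
      have "f (inv_into (faces P) f x) = x" if "x \<in> faces P" for x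
        by (rule f_inv_into_f) (simp add: img that)
      moreover have "le (f (inv_into (faces P) f F)) (f (inv_into (faces P) f G))
          \<longleftrightarrow> le (inv_into (faces P) f F) (inv_into (faces P) f G)"
        using f Bij_inv_into_mem[OF fB that(1)] Bij_inv_into_mem[OF fB that(2)] by simp
      ultimately show ?thesis using that by simp
    qed
    then show "inv\<^bsub>BijGroup (faces P)\<^esub> f \<in> ?A"
      using fB by (simp add: inv_BijGroup restrict_inv_into_Bij)
    fix g assume g: "g \<in> ?A"
    then have "\<And>F. F \<in> faces P \<Longrightarrow> g F \<in> faces P" using Bij_imp_funcset by blast
    then show "f \<otimes>\<^bsub>BijGroup (faces P)\<^esub> g \<in> ?A"
      using f g compose_Bij[of f "faces P" g] by (auto simp: BijGroup_def compose_def)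
  qed
  then show ?thesis
    unfolding aut_group_def by (rule subgroup.subgroup_is_group) (rule group_BijGroup)
qed

sublocale Aut: group Aut
  by (rule group_Aut)

lemma Aut_image_mult:
  "f \<in> carrier Aut \<Longrightarrow> g \<in> carrier Aut \<Longrightarrow> A \<subseteq> faces P \<Longrightarrow> (f \<otimes>\<^bsub>Aut\<^esub> g) ` A = f ` g ` A"
  by (force simp: Aut_mult compose_def)

lemma Aut_image_one: "A \<subseteq> faces P \<Longrightarrow> \<one>\<^bsub>Aut\<^esub> ` A = A"
  by (force simp: Aut_one)

lemma Aut_flag:
  assumes f: "f \<in> carrier Aut" and \<Phi>: "\<Phi> \<in> flags P"
  shows "f ` \<Phi> \<in> flags P"
proof (rule flagI)
  have "\<forall>a \<in> \<Phi>. \<forall>b \<in> \<Phi>. le a b \<or> le b a" using \<Phi> by (auto simp: flags_def Chains_def)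
  then show "f ` \<Phi> \<in> Chains (incid P)"
    using Aut_le[OF f] flag_faces[OF \<Phi>] unfolding Chains_def by blast
  show "card (f ` \<Phi>) = n + 2"
    using card_image[OF inj_on_subset[OF Aut_inj[OF f] flag_faces[OF \<Phi>]]] card_flag[OF \<Phi>] by simp
qed

text \<open>This recovers the rank from the order alone, so that automorphisms, which are defined by
  incidence, preserve it. The 2 accounts for rank -1 and rank 0 in the count of ranks from -1 to
  \<open>rank P F\<close>.\<close>

lemma card_below:
  assumes \<Phi>: "\<Phi> \<in> flags P" and F: "F \<in> \<Phi>"
  shows "int (card {G \<in> \<Phi>. le G F}) = rank P F + 2"
proof -
  have "{G \<in> \<Phi>. le G F} = {G \<in> \<Phi>. rank P G \<le> rank P F}"
    using rank_le flag_le[OF \<Phi> _ F] by blast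
  moreover have "rank P ` {G \<in> \<Phi>. rank P G \<le> rank P F} = {-1..rank P F}"
  proof
    show "{-1..rank P F} \<subseteq> rank P ` {G \<in> \<Phi>. rank P G \<le> rank P F}"
    proof
      fix k assume k: "k \<in> {-1..rank P F}"
      then have "k \<in> {-1..int n}" using rank_range[OF \<Phi> F] by auto
      then show "k \<in> rank P ` {G \<in> \<Phi>. rank P G \<le> rank P F}"
        using k rank_face_at[OF \<Phi>] face_at_in[OF \<Phi>] by (intro image_eqI[of _ _ "face_at \<Phi> k"]) auto
    qed
  qed (use rank_range[OF \<Phi>] in auto)
  moreover have "inj_on (rank P) {G \<in> \<Phi>. rank P G \<le> rank P F}"
    using bij_rank[OF \<Phi>] by (auto simp: bij_betw_def inj_on_def)
  ultimately have "card {G \<in> \<Phi>. le G F} = card {-1..rank P F}" by (metis card_image)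
  then show ?thesis using rank_range[OF \<Phi> F] by simp
qed

lemma Aut_rank:
  assumes f: "f \<in> carrier Aut" and \<Phi>: "\<Phi> \<in> flags P" and F: "F \<in> \<Phi>"
  shows "rank P (f F) = rank P F"
proof -
  have sub: "\<Phi> \<subseteq> faces P" by (rule flag_faces[OF \<Phi>])
  have "{G \<in> f ` \<Phi>. le G (f F)} = f ` {G \<in> \<Phi>. le G F}"
    using Aut_le[OF f] sub F by blast
  moreover have "inj_on f {G \<in> \<Phi>. le G F}"
    by (rule inj_on_subset[OF Aut_inj[OF f]]) (use sub in blast)
  ultimately have "card {G \<in> f ` \<Phi>. le G (f F)} = card {G \<in> \<Phi>. le G F}" by (simp add: card_image)
  then show ?thesis using card_below[OF \<Phi> F] card_below[OF Aut_flag[OF f \<Phi>], of "f F"] F by simp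
qed

lemma Aut_face_at:
  assumes "f \<in> carrier Aut" "\<Phi> \<in> flags P" "k \<in> {-1..int n}"
  shows "face_at (f ` \<Phi>) k = f (face_at \<Phi> k)"
  using assms by (intro face_at_eqI Aut_flag) (auto simp: Aut_rank[OF _ _ face_at_in] rank_face_at face_at_in)

lemma Aut_adj:
  assumes f: "f \<in> carrier Aut" and \<Phi>: "\<Phi> \<in> flags P" and i: "i < n"
  shows "f ` adj i \<Phi> = adj i (f ` \<Phi>)"
proof -
  have \<Psi>: "adj i \<Phi> \<in> flags P" and ad: "i_adjacent P i \<Phi> (adj i \<Phi>)"
    using adj_flag i_adjacent_adj \<Phi> i by auto
  have "f ` \<Phi> \<noteq> f ` adj i \<Phi>"
    using inj_on_image_eq_iff[OF Aut_inj[OF f] flag_faces[OF \<Phi>] flag_faces[OF \<Psi>]] ad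
    by (simp add: i_adjacent_def)
  then have "i_adjacent P i (f ` \<Phi>) (f ` adj i \<Phi>)"
    using i_adjacent_iff[OF Aut_flag[OF f \<Phi>] Aut_flag[OF f \<Psi>]] i_adjacent_face_at[OF ad]
      Aut_face_at[OF f \<Phi>] Aut_face_at[OF f \<Psi>] by simp
  then show ?thesis using adj_eqI i by metis
qed

text \<open>As \<open>f\<close> commutes with adjacency, fixing one flag propagates to all flags by
  connectedness. Every face lies in a flag and keeps its rank, so it is fixed too.\<close>

lemma Aut_stabilizer_trivial:
  assumes f: "f \<in> carrier Aut" and \<Phi>: "\<Phi> \<in> flags P" and fixed: "f ` \<Phi> = \<Phi>"
  shows "f = \<one>\<^bsub>Aut\<^esub>"
proof -
  have all: "f ` \<Psi> = \<Psi>" if \<Psi>: "\<Psi> \<in> flags P" for \<Psi>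
    using flag_connected[OF \<Phi> \<Psi>]
  proof (induction rule: rtrancl_induct)
    case (step A B)
    then obtain i where ad: "i_adjacent P i A B" by (auto simp: adjacent_def)
    then have i: "i < n" and A: "A \<in> flags P" using i_adjacent_less i_adjacent_flags by auto
    then show ?case using Aut_adj[OF f A i] adj_eqI[OF ad i] step.IH by simp
  qed (rule fixed)
  have fixes_face: "f F = F" if F: "F \<in> faces P" for F
  proof -
    have "{F} \<in> Chains (incid P)" using le_refl[OF F] by (simp add: Chains_def)
    then obtain \<Psi> where \<Psi>: "\<Psi> \<in> flags P" "F \<in> \<Psi>" using chain_extends_to_flag[of "{F}"] by auto
    then have "f F \<in> \<Psi>" using all by blast
    then show ?thesis using face_at_rank[OF \<Psi>(1)] Aut_rank[OF f \<Psi>] \<Psi>(2) by metis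
  qed
  show ?thesis
  proof (rule extensionalityI[of _ "faces P"])
    show "f \<in> extensional (faces P)" using f by (simp add: Aut_carrier Bij_def)
  qed (simp_all add: Aut_one fixes_face)
qed

lemma Aut_eqI:
  assumes f: "f \<in> carrier Aut" and g: "g \<in> carrier Aut" and \<Phi>: "\<Phi> \<in> flags P" and eq: "f ` \<Phi> = g ` \<Phi>"
  shows "f = g"
proof -
  have sub: "\<Phi> \<subseteq> faces P" by (rule flag_faces[OF \<Phi>])
  have "(inv\<^bsub>Aut\<^esub> g \<otimes>\<^bsub>Aut\<^esub> f) ` \<Phi> = (inv\<^bsub>Aut\<^esub> g) ` g ` \<Phi>"
    using f g sub eq by (simp add: Aut_image_mult)
  also have "\<dots> = (inv\<^bsub>Aut\<^esub> g \<otimes>\<^bsub>Aut\<^esub> g) ` \<Phi>"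
    by (rule Aut_image_mult[symmetric]) (use g sub in auto)
  also have "\<dots> = \<Phi>" using g sub by (simp add: Aut_image_one)
  finally have "(inv\<^bsub>Aut\<^esub> g \<otimes>\<^bsub>Aut\<^esub> f) ` \<Phi> = \<Phi>" .
  then have "inv\<^bsub>Aut\<^esub> g \<otimes>\<^bsub>Aut\<^esub> f = \<one>\<^bsub>Aut\<^esub>" using Aut_stabilizer_trivial \<Phi> f g by simp
  then show ?thesis using f g by (metis Aut.inv_closed Aut.inv_equality Aut.inv_inv)
qed

end

section \<open>Rotation groups as quotients of \<open>W\<^sup>+\<close>\<close>

lemma carrier_generated_rotary [simp]: "carrier (generated_rotary n G s) = generate G (s ` {1..<n})"
  and mult_generated_rotary [simp]: "monoid.mult (generated_rotary n G s) = monoid.mult G"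
  and one_generated_rotary [simp]: "\<one>\<^bsub>generated_rotary n G s\<^esub> = \<one>\<^bsub>G\<^esub>"
  and gen_generated_rotary [simp]: "gen (generated_rotary n G s) = s"
  by (simp_all add: generated_rotary_def)

context
  fixes n :: nat and G :: "('g, 'y) monoid_scheme" and s :: "nat \<Rightarrow> 'g"
  assumes G: "group G" and img: "Wplus_images n G s"
begin

lemma subgroup_generate_images: "subgroup (generate G (s ` {1..<n})) G"
  using group.generate_is_subgroup[OF G] Wplus_images_closed[OF G img] by blast

lemma inv_generated_rotary:
  assumes "x \<in> generate G (s ` {1..<n})"
  shows "inv\<^bsub>generated_rotary n G s\<^esub> x = inv\<^bsub>G\<^esub> x"
proof -
  \<comment> \<open>The inverse depends only on carrier, product and unit, so the
    \<open>rotary\<close> record may be exchanged for the ordinary subgroup record.\<close>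
  have "inv\<^bsub>generated_rotary n G s\<^esub> x = inv\<^bsub>G\<lparr>carrier := generate G (s ` {1..<n})\<rparr>\<^esub> x"
    by (simp add: m_inv_def)
  then show ?thesis using group.m_inv_consistent[OF G subgroup_generate_images assms] by simp
qed

lemma group_generated_rotary: "group (generated_rotary n G s)"
proof (rule groupI)
  interpret G: group G by (rule G)
  interpret H: subgroup "generate G (s ` {1..<n})" G by (rule subgroup_generate_images)
  let ?H = "generated_rotary n G s"
  show "\<one>\<^bsub>?H\<^esub> \<in> carrier ?H" by (simp add: generate.one)
  fix x assume x: "x \<in> carrier ?H"
  then show "\<one>\<^bsub>?H\<^esub> \<otimes>\<^bsub>?H\<^esub> x = x" by (simp del: One_nat_def)
  show "\<exists>y \<in> carrier ?H. y \<otimes>\<^bsub>?H\<^esub> x = \<one>\<^bsub>?H\<^esub>"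
    using x by (intro bexI[of _ "inv\<^bsub>G\<^esub> x"]) (simp_all del: One_nat_def)
  fix y assume y: "y \<in> carrier ?H"
  then show "x \<otimes>\<^bsub>?H\<^esub> y \<in> carrier ?H" using x by (simp del: One_nat_def)
  fix z assume "z \<in> carrier ?H"
  then show "x \<otimes>\<^bsub>?H\<^esub> y \<otimes>\<^bsub>?H\<^esub> z = x \<otimes>\<^bsub>?H\<^esub> (y \<otimes>\<^bsub>?H\<^esub> z)"
    using x y by (simp add: G.m_assoc del: One_nat_def)
qed

lemma word_eval_generated_rotary:
  "w \<in> words {1..<n} \<Longrightarrow> word_eval (generated_rotary n G s) s w = word_eval G s w"
proof (induction w)
  case (Cons l w)
  obtain x b where l: "l = (x, b)" "x \<in> {1..<n}" and w: "w \<in> words {1..<n}"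
    using Cons.prems by (cases l) (auto simp: words_def)
  then have "s x \<in> generate G (s ` {1..<n})" by (blast intro: generate.incl)
  then show ?case
    using Cons.IH[OF w] l(1) by (simp add: word_eval_def inv_generated_rotary)
qed (simp add: word_eval_def)

lemma Wplus_images_generated_rotary: "Wplus_images n (generated_rotary n G s) s"
  using img unfolding Wplus_images_def
  by (simp add: word_eval_generated_rotary upt_word_words subset_iff) (blast intro: generate.incl)

lemma pres_hom_generated_rotary:
  assumes "w \<in> carrier (Wplus n)"
  shows "pres_hom (generated_rotary n G s) s w = pres_hom G s w"
proof -
  obtain v where "v \<in> words {1..<n}" "w = pres_rel {1..<n} (Wplus_relators n) `` {v}"
    using assms by (auto simp: Wplus_def carrier_presented_group)
  then show ?thesis
    using pres_hom_Wplus_class[OF G img] word_eval_generated_rotary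
      pres_hom_Wplus_class[OF group_generated_rotary Wplus_images_generated_rotary] by simp
qed

text \<open>The kernel can thus be computed in the ambient group, where elements outside the
  rotation group, such as reflections, are available for conjugation.\<close>

lemma rel_subgroup_generated_rotary:
  "rel_subgroup n (generated_rotary n G s) = kernel (Wplus n) G (pres_hom G s)"
  by (auto simp: rel_subgroup_def kernel_def pres_hom_generated_rotary)

lemma pres_hom_image: "pres_hom G s ` carrier (Wplus n) = generate G (s ` {1..<n})"
proof
  interpret h: group_hom "Wplus n" G "pres_hom G s" by (rule group_hom_pres_hom[OF G img])
  interpret h': group_hom "Wplus n" "generated_rotary n G s" "pres_hom (generated_rotary n G s) s"
    by (rule group_hom_pres_hom[OF group_generated_rotary Wplus_images_generated_rotary])
  show "pres_hom G s ` carrier (Wplus n) \<subseteq> generate G (s ` {1..<n})"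
    using h'.hom_closed by (auto simp: pres_hom_generated_rotary)
  have "s i \<in> pres_hom G s ` carrier (Wplus n)" if "i \<in> {1..<n}" for i
    using pres_hom_Wplus_gen[OF G img that] Wplus_gen_closed[OF that] by (metis imageI)
  then show "generate G (s ` {1..<n}) \<subseteq> pres_hom G s ` carrier (Wplus n)"
    by (intro h.H.generate_subgroup_incl h.img_is_subgroup) auto
qed

end

section \<open>Relation subgroups of mixes and the isomorphism of chirality groups\<close>

lemma rel_subgroup_mix:
  fixes G :: "'g rotary" and H :: "'h rotary"
  assumes G: "group G" "Wplus_images n G (gen G)" and H: "group H" "Wplus_images n H (gen H)"
  shows "rel_subgroup n (mix n G H) = rel_subgroup n G \<inter> rel_subgroup n H"
proof -
  interpret G: group G by fact
  interpret H: group H by fact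
  let ?s = "\<lambda>i. (gen G i, gen H i)"
  have D: "group (G \<times>\<times> H)" by (rule DirProd_group[OF G(1) H(1)])
  have cl: "gen G i \<in> carrier G" "gen H i \<in> carrier H" if "i \<in> {1..<n}" for i
    using Wplus_images_closed[OF G] Wplus_images_closed[OF H] that by auto
  \<comment> \<open>Words evaluate componentwise in the direct product, so the kernel for the mix is
    the intersection of the two kernels.\<close>
  have ev: "word_eval (G \<times>\<times> H) ?s w = (word_eval G (gen G) w, word_eval H (gen H) w)"
    if "w \<in> words {1..<n}" for w
    using that
  proof (induction w)
    case (Cons l w)
    then show ?case using cl by (cases l) (auto simp: word_eval_def words_def inv_DirProd[OF G(1) H(1)])
  qed (simp add: word_eval_def)
  have "Wplus_images n (G \<times>\<times> H) ?s"
    using G(2) H(2) cl unfolding Wplus_images_def by (simp add: ev upt_word_words subset_iff)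
  note img = this
  have hom: "pres_hom (G \<times>\<times> H) ?s w = (pres_hom G (gen G) w, pres_hom H (gen H) w)"
    if "w \<in> carrier (Wplus n)" for w
  proof -
    obtain v where "v \<in> words {1..<n}" "w = pres_rel {1..<n} (Wplus_relators n) `` {v}"
      using \<open>w \<in> carrier (Wplus n)\<close> by (auto simp: Wplus_def carrier_presented_group)
    then show ?thesis
      by (simp add: ev pres_hom_Wplus_class[OF D img] pres_hom_Wplus_class[OF G]
          pres_hom_Wplus_class[OF H] del: One_nat_def)
  qed
  show ?thesis
    unfolding mix_def rel_subgroup_generated_rotary[OF D img]
    by (auto simp: rel_subgroup_def kernel_def hom)
qed

text \<open>The group-theoretic core. The regular polytope enters only through invariance of its
  relation subgroup under \<open>conj_aut n\<close> and, in rank above 2, through non-commuting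
  elements.\<close>

lemma natural_projection_iso:
  fixes G :: "'g rotary" and H :: "'h rotary"
  assumes G: "group G" "Wplus_images n G (gen G)"
    and H: "simple_group H" "Wplus_images n H (gen H)" "carrier H = generate H (gen H ` {1..<n})"
    and conj_H: "\<And>w. w \<in> rel_subgroup n H \<Longrightarrow> conj_aut n w \<in> rel_subgroup n H"
    and nonabelian: "2 < n \<Longrightarrow> \<exists>x \<in> carrier H. \<exists>y \<in> carrier H. x \<otimes>\<^bsub>H\<^esub> y \<noteq> y \<otimes>\<^bsub>H\<^esub> x"
  shows "natural_projection n G \<in> iso (chirality_group n (mix n G H)) (chirality_group n G)"
proof -
  interpret W: group "Wplus n" by (rule group_Wplus)
  interpret H: simple_group H by fact
  let ?W = "Wplus n" and ?c = "conj_aut n"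
  let ?M = "rel_subgroup n G" and ?K = "rel_subgroup n H"
  let ?N = "?M \<inter> ?K"
  have hG: "group_hom ?W G (pres_hom G (gen G))" by (rule group_hom_pres_hom[OF G])
  have hH: "group_hom ?W H (pres_hom H (gen H))" by (rule group_hom_pres_hom[OF H.is_group H(2)])
  have M: "?M \<lhd> ?W" and K: "?K \<lhd> ?W"
    using group_hom.normal_kernel[OF hG] group_hom.normal_kernel[OF hH] by (simp_all add: rel_subgroup_def)
  have N: "?N \<lhd> ?W" by (rule W.normal_subgroup_intersect[OF M K])
  have cM: "?c ` ?M \<lhd> ?W" and cN: "?c ` ?N \<lhd> ?W" using conj_aut_normal M N by blast+
  have sub: "?M \<subseteq> carrier ?W" "?K \<subseteq> carrier ?W" by (auto simp: rel_subgroup_def kernel_def)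
  have cNK: "?c ` ?N \<subseteq> ?K" using conj_H by blast
  \<comment> \<open>Since \<open>conj_aut n\<close> is an involution preserving \<open>?K\<close>,
    the preimage \<open>m\<close> of an element of \<open>?K\<close> is again in
    \<open>?K\<close>.\<close>
  have cN_eq: "?c ` ?M \<inter> ?K \<subseteq> ?c ` ?N"
  proof
    fix w assume w: "w \<in> ?c ` ?M \<inter> ?K"
    then obtain m where m: "m \<in> ?M" "w = ?c m" by blast
    then have "m = ?c w" using conj_aut_conj_aut[of m n] sub by auto
    then show "w \<in> ?c ` ?N" using m w conj_H by blast
  qed
  have one: "\<one>\<^bsub>?W\<^esub> \<in> ?N" by (rule subgroup.one_closed[OF normal_imp_subgroup[OF N]])
  \<comment> \<open>This inclusion is the surjectivity of the projection; ranks above 2 and rank 2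
    need different arguments.\<close>
  have cM_sub: "?c ` ?M \<subseteq> ?M <#>\<^bsub>?W\<^esub> ?c ` ?N"
  proof (cases "2 < n")
    case True
    then obtain x y where xy: "x \<in> carrier H" "y \<in> carrier H" "x \<otimes>\<^bsub>H\<^esub> y \<noteq> y \<otimes>\<^bsub>H\<^esub> x"
      using nonabelian by blast
    have surj: "pres_hom H (gen H) ` carrier ?W = carrier H"
      using pres_hom_image[OF H.is_group H(2)] H(3) by simp
    have "?c ` ?M \<subseteq> ?K" if "?M \<subseteq> ?K" using that conj_H by blast
    then have "?c ` ?M \<subseteq> ?M <#>\<^bsub>?W\<^esub> (?c ` ?M \<inter> ?K)"
      using normal_subset_set_mult_Int_kernel[OF hH surj H(1) xy M cM]
      by (simp add: rel_subgroup_def)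
    then show ?thesis using mono_set_mult[OF subset_refl cN_eq] by blast
  next
    case False
    \<comment> \<open>For \<open>n \<le> 1\<close> there are no generators, and \<open>H\<close>
      would be trivial, contrary to simplicity.\<close>
    have "n = 2"
    proof (rule ccontr)
      assume "n \<noteq> 2"
      then have "{1..<n} = {}" using False by auto
      then have "carrier H = {\<one>\<^bsub>H\<^esub>}" using H(3) H.generate_empty by simp
      then show False using H.simple_not_triv by simp
    qed
    show ?thesis
    proof
      fix w assume "w \<in> ?c ` ?M"
      then obtain m where m: "m \<in> ?M" "w = ?c m" by blast
      then have "w = inv\<^bsub>?W\<^esub> m" using conj_aut_rank_2[of m] sub \<open>n = 2\<close> by auto
      then have "w \<in> ?M" using m(1) subgroup.m_inv_closed[OF normal_imp_subgroup[OF M]] by simp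
      moreover have "?c \<one>\<^bsub>?W\<^esub> = \<one>\<^bsub>?W\<^esub>"
        using conj_aut_hom hom_one[OF _ group_Wplus group_Wplus] by blast
      then have "\<one>\<^bsub>?W\<^esub> \<in> ?c ` ?N" using one by (metis imageI)
      moreover have "w = w \<otimes>\<^bsub>?W\<^esub> \<one>\<^bsub>?W\<^esub>" using \<open>w \<in> ?M\<close> sub by auto
      ultimately show "w \<in> ?M <#>\<^bsub>?W\<^esub> ?c ` ?N" unfolding set_mult_def by blast
    qed
  qed
  interpret M: normal ?M ?W by (rule M)
  interpret K: normal ?K ?W by (rule K)
  have car: "a \<in> carrier ?W" if "a \<in> ?c ` ?M" for a
    using that cM normal_imp_subgroup subgroup.subset by blast
  have "(\<lambda>C. ?M <#>\<^bsub>?W\<^esub> C) \<in>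
    iso (?W\<lparr>carrier := ?N <#>\<^bsub>?W\<^esub> ?c ` ?N\<rparr> Mod ?N) (?W\<lparr>carrier := ?M <#>\<^bsub>?W\<^esub> ?c ` ?M\<rparr> Mod ?M)"
  proof (rule W.set_mult_iso_FactGroup[OF M N])
    show "subgroup (?N <#>\<^bsub>?W\<^esub> ?c ` ?N) ?W" "subgroup (?M <#>\<^bsub>?W\<^esub> ?c ` ?M) ?W"
      by (rule W.mult_norm_subgroup[OF N normal_imp_subgroup[OF cN]], rule W.mult_norm_subgroup[OF M normal_imp_subgroup[OF cM]])
    show "?N <#>\<^bsub>?W\<^esub> ?c ` ?N \<subseteq> ?M <#>\<^bsub>?W\<^esub> ?c ` ?M"
      by (rule mono_set_mult) auto
    \<comment> \<open>Both factors lie in \<open>?K\<close>, which gives injectivity: what also lies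
      in \<open>?M\<close> is in \<open>?N\<close>.\<close>
    have "?N <#>\<^bsub>?W\<^esub> ?c ` ?N \<subseteq> ?K"
      using cNK K.m_closed unfolding set_mult_def by blast
    then show "?M \<inter> (?N <#>\<^bsub>?W\<^esub> ?c ` ?N) \<subseteq> ?N" by blast
    show "?M <#>\<^bsub>?W\<^esub> ?c ` ?M \<subseteq> ?M <#>\<^bsub>?W\<^esub> (?N <#>\<^bsub>?W\<^esub> ?c ` ?N)"
    proof
      fix a assume "a \<in> ?M <#>\<^bsub>?W\<^esub> ?c ` ?M"
      then obtain m m' where m: "m \<in> ?M" "m' \<in> ?c ` ?M" "a = m \<otimes>\<^bsub>?W\<^esub> m'"
        unfolding set_mult_def by blast
      have "m' \<in> ?M <#>\<^bsub>?W\<^esub> ?c ` ?N" by (rule subsetD[OF cM_sub m(2)])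
      then obtain m1 k where k: "m1 \<in> ?M" "k \<in> ?c ` ?N" "m' = m1 \<otimes>\<^bsub>?W\<^esub> k"
        unfolding set_mult_def by (elim UN_E singletonE)
      have kc: "k \<in> carrier ?W" by (rule car) (use k(2) in auto)
      have "\<one>\<^bsub>?W\<^esub> \<otimes>\<^bsub>?W\<^esub> k \<in> ?N <#>\<^bsub>?W\<^esub> ?c ` ?N"
        unfolding set_mult_def using one k(2) by blast
      then have "k \<in> ?N <#>\<^bsub>?W\<^esub> ?c ` ?N" using kc by simp
      moreover have "a = (m \<otimes>\<^bsub>?W\<^esub> m1) \<otimes>\<^bsub>?W\<^esub> k" using m k kc sub by (simp add: W.m_assoc)
      moreover have "m \<otimes>\<^bsub>?W\<^esub> m1 \<in> ?M" using m k by simp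
      ultimately show "a \<in> ?M <#>\<^bsub>?W\<^esub> (?N <#>\<^bsub>?W\<^esub> ?c ` ?N)" unfolding set_mult_def by blast
    qed
  qed simp
  then show ?thesis
    unfolding chirality_group_def Let_def natural_projection_def[abs_def]
      rel_subgroup_mix[OF G H.is_group H(2)] .
qed

section \<open>Rotation groups of chiral and regular polytopes\<close>

context finite_polytope
begin

lemma Aut_flag_image_eq:
  "f \<in> carrier Aut \<Longrightarrow> g \<in> carrier Aut \<Longrightarrow> \<Phi> \<in> flags P \<Longrightarrow> (f \<otimes>\<^bsub>Aut\<^esub> g) ` \<Phi> = f ` g ` \<Phi>"
  by (rule Aut_image_mult[OF _ _ flag_faces])

text \<open>The product telescopes: automorphisms commute with adjacency, so each further rotation
  cancels the last adjacency and adds the next. Arguing on flags covers chiral polytopes, which have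
  no reflections.\<close>

lemma rotations_upt_word:
  assumes \<Phi>: "\<Phi> \<in> flags P" and cl: "s \<in> {1..<n} \<rightarrow> carrier Aut"
    and s: "\<And>i. i \<in> {1..<n} \<Longrightarrow> s i ` \<Phi> = adj i (adj (i - 1) \<Phi>)"
    and ij: "1 \<le> i" "i \<le> j" "j < n"
  shows "word_eval Aut s (upt_word i j) ` \<Phi> = adj j (adj (i - 1) \<Phi>)"
  using ij(2,3)
proof (induction j rule: dec_induct)
  case base
  have "s i \<in> carrier Aut" using cl ij by auto
  then show ?case using word_eval_upt_word_same[of Aut s i] s ij group_Aut by simp
next
  case (step j)
  let ?w = "word_eval Aut s (upt_word i j)"
  have w: "?w \<in> carrier Aut"
    by (rule Aut.word_eval_closed[OF cl upt_word_words]) (use ij step in auto)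
  have sj: "s (Suc j) \<in> carrier Aut" using cl step by auto
  have fl: "adj j \<Phi> \<in> flags P" "adj (i - 1) \<Phi> \<in> flags P" using adj_flag \<Phi> step ij by auto
  have "word_eval Aut s (upt_word i (Suc j)) = ?w \<otimes>\<^bsub>Aut\<^esub> s (Suc j)"
    by (rule word_eval_upt_word_Suc[OF group_Aut cl]) (use ij step in auto)
  then have "word_eval Aut s (upt_word i (Suc j)) ` \<Phi> = ?w ` adj (Suc j) (adj j \<Phi>)"
    using s[of "Suc j"] w sj \<Phi> step by (simp add: Aut_flag_image_eq)
  also have "\<dots> = adj (Suc j) (adj j (?w ` \<Phi>))"
    using Aut_adj[OF w] fl \<Phi> step by simp
  also have "\<dots> = adj (Suc j) (adj (i - 1) \<Phi>)"
    using step.IH adj_adj[OF fl(2), of j] step by simp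
  finally show ?case .
qed

text \<open>For \<open>i < j\<close> the ranks \<open>i - 1\<close> and \<open>j\<close> differ by
  at least 2, so their adjacencies commute. The square of the product then fixes the base flag and
  is the identity by freeness of the action.\<close>

lemma Wplus_images_rotations:
  assumes \<Phi>: "\<Phi> \<in> flags P" and cl: "s \<in> {1..<n} \<rightarrow> carrier Aut"
    and s: "\<And>i. i \<in> {1..<n} \<Longrightarrow> s i ` \<Phi> = adj i (adj (i - 1) \<Phi>)"
  shows "Wplus_images n Aut s"
  unfolding Wplus_images_def
proof (intro conjI allI impI)
  fix i j assume ij: "1 \<le> i \<and> i < j \<and> j < n"
  let ?w = "word_eval Aut s (upt_word i j)"
  have w: "?w \<in> carrier Aut"
    by (rule Aut.word_eval_closed[OF cl upt_word_words]) (use ij in auto)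
  have i: "i - 1 < n" "j < n" using ij by auto
  have w\<Phi>: "?w ` \<Phi> = adj j (adj (i - 1) \<Phi>)"
    using rotations_upt_word[OF assms] ij by simp
  have fl: "adj (i - 1) \<Phi> \<in> flags P" "adj j \<Phi> \<in> flags P" using adj_flag \<Phi> i by auto
  have "(?w \<otimes>\<^bsub>Aut\<^esub> ?w) ` \<Phi> = ?w ` adj j (adj (i - 1) \<Phi>)"
    using w w\<Phi> \<Phi> by (simp add: Aut_flag_image_eq)
  also have "\<dots> = adj j (adj (i - 1) (adj j (adj (i - 1) \<Phi>)))"
    using Aut_adj[OF w] w\<Phi> fl \<Phi> i by simp
  also have "\<dots> = adj j (adj (i - 1) (adj (i - 1) (adj j \<Phi>)))"
    using adj_commute[OF \<Phi> i] ij by auto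
  also have "\<dots> = \<Phi>" using adj_adj fl \<Phi> i by simp
  finally have "(?w \<otimes>\<^bsub>Aut\<^esub> ?w) ` \<Phi> = \<Phi>" .
  then show "?w \<otimes>\<^bsub>Aut\<^esub> ?w = \<one>\<^bsub>Aut\<^esub>" using Aut_stabilizer_trivial \<Phi> w by simp
qed (rule cl)

text \<open>Freeness of the action makes the definite descriptions of reflections and rotations well
  defined as soon as some automorphism does the job.\<close>

lemma the_Aut:
  assumes "\<Phi> \<in> flags P" "\<exists>f \<in> carrier Aut. f ` \<Phi> = \<Psi>"
  shows "(THE f. f \<in> carrier Aut \<and> f ` \<Phi> = \<Psi>) \<in> carrier Aut \<and>
    (THE f. f \<in> carrier Aut \<and> f ` \<Phi> = \<Psi>) ` \<Phi> = \<Psi>"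
proof -
  obtain f where f: "f \<in> carrier Aut" "f ` \<Phi> = \<Psi>" using assms(2) by blast
  have "\<exists>!f. f \<in> carrier Aut \<and> f ` \<Phi> = \<Psi>"
    by (rule ex1I[of _ f]) (use f Aut_eqI[OF _ _ assms(1)] in auto)
  from theI'[OF this] show ?thesis .
qed

text \<open>There are two orbits and each adjacency switches between them, so two adjacencies lead
  back to the orbit of the base flag.\<close>

lemma chiral_rotation:
  assumes chiral: "chiral_polytope n P" and \<Phi>: "\<Phi> \<in> flags P" and i: "i \<in> {1..<n}"
  shows "chiral_rotation P \<Phi> i \<in> carrier Aut" "chiral_rotation P \<Phi> i ` \<Phi> = adj i (adj (i - 1) \<Phi>)"
proof -
  let ?o = "orbit Aut (\<lambda>f \<Phi>. f ` \<Phi>)" and ?A = "adj (i - 1) \<Phi>" and ?B = "adj i (adj (i - 1) \<Phi>)"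
  have A: "?A \<in> flags P" and B: "?B \<in> flags P" using adj_flag \<Phi> i by auto
  have "i_adjacent P (i - 1) \<Phi> ?A" "i_adjacent P i ?A ?B"
    using i_adjacent_adj[OF \<Phi>, of "i - 1"] i_adjacent_adj[OF A, of i] i by auto
  then have "adjacent P \<Phi> ?A" "adjacent P ?A ?B" unfolding adjacent_def by blast+
  then have ne: "?o \<Phi> \<noteq> ?o ?A" "?o ?A \<noteq> ?o ?B"
    using chiral by (simp_all add: chiral_polytope_def)
  have "card (orbits Aut (flags P) (\<lambda>f \<Phi>. f ` \<Phi>)) = 2"
    using chiral by (simp add: chiral_polytope_def)
  then obtain X Y where XY: "orbits Aut (flags P) (\<lambda>f \<Phi>. f ` \<Phi>) = {X, Y}"
    by (auto simp: card_2_iff)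
  have mem: "?o \<Psi> \<in> {X, Y}" if "\<Psi> \<in> flags P" for \<Psi>
    using that unfolding XY[symmetric] orbits_def by blast
  have "?o \<Phi> = ?o ?B" using mem[OF \<Phi>] mem[OF A] mem[OF B] ne by auto
  moreover have "\<one>\<^bsub>Aut\<^esub> ` ?B \<in> ?o ?B" unfolding orbit_def using Aut.one_closed by blast
  then have "?B \<in> ?o ?B" using Aut_image_one[OF flag_faces[OF B]] by simp
  ultimately have "?B \<in> ?o \<Phi>" by simp
  then have "\<exists>f \<in> carrier Aut. f ` \<Phi> = ?B" unfolding orbit_def by auto
  then show "chiral_rotation P \<Phi> i \<in> carrier Aut" "chiral_rotation P \<Phi> i ` \<Phi> = ?B"
    using the_Aut[OF \<Phi>] unfolding chiral_rotation_def by auto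
qed

lemma Wplus_images_chiral_rotation:
  assumes "chiral_polytope n P" "\<Phi> \<in> flags P"
  shows "Wplus_images n Aut (chiral_rotation P \<Phi>)"
proof (rule Wplus_images_rotations[OF assms(2)])
  show "chiral_rotation P \<Phi> \<in> {1..<n} \<rightarrow> carrier Aut" using chiral_rotation(1)[OF assms] by blast
qed (rule chiral_rotation(2)[OF assms])

end

section \<open>Regular polytopes: reflections, and simple rotation groups\<close>

locale finite_regular_polytope = finite_polytope +
  fixes \<Phi>
  assumes regular: "regular_polytope n P" and base: "\<Phi> \<in> flags P"
begin

abbreviation \<rho> :: "nat \<Rightarrow> 'a \<Rightarrow> 'a" where
  "\<rho> \<equiv> reflection P \<Phi>"

definition rot :: "nat \<Rightarrow> 'a \<Rightarrow> 'a" where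
  "rot i = \<rho> (i - 1) \<otimes>\<^bsub>Aut\<^esub> \<rho> i"

lemma regular_rotation_group_eq: "regular_rotation_group n P \<Phi> = generated_rotary n Aut rot"
  by (simp add: regular_rotation_group_def rot_def[abs_def])

lemma
  assumes i: "i < n"
  shows reflection_closed: "\<rho> i \<in> carrier Aut" and reflection_flag: "\<rho> i ` \<Phi> = adj i \<Phi>"
proof -
  have "\<exists>f \<in> carrier Aut. f ` \<Phi> = adj i \<Phi>"
    using regular base adj_flag[OF base i] by (simp add: regular_polytope_def)
  then show "\<rho> i \<in> carrier Aut" "\<rho> i ` \<Phi> = adj i \<Phi>"
    using the_Aut[OF base] by (auto simp: reflection_def)
qed

text \<open>The indices come out reversed because \<rho> i is moved past the
  \<open>j\<close>-adjacency before it acts on the base flag.\<close>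

lemma reflection_mult_flag:
  assumes "i < n" "j < n"
  shows "(\<rho> i \<otimes>\<^bsub>Aut\<^esub> \<rho> j) ` \<Phi> = adj j (adj i \<Phi>)"
  using assms base reflection_closed Aut_adj[OF reflection_closed[OF assms(1)] base assms(2)]
  by (simp add: Aut_flag_image_eq reflection_flag)

lemma reflection_square: "i < n \<Longrightarrow> \<rho> i \<otimes>\<^bsub>Aut\<^esub> \<rho> i = \<one>\<^bsub>Aut\<^esub>"
  using reflection_mult_flag[of i i] adj_adj[OF base] reflection_closed
  by (intro Aut_stabilizer_trivial[OF _ base]) auto

lemma reflection_commute:
  assumes "i < n" "j < n" "i + 2 \<le> j"
  shows "\<rho> i \<otimes>\<^bsub>Aut\<^esub> \<rho> j = \<rho> j \<otimes>\<^bsub>Aut\<^esub> \<rho> i"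
  using reflection_mult_flag[of i j] reflection_mult_flag[of j i] adj_commute[OF base] assms reflection_closed
  by (intro Aut_eqI[OF _ _ base]) auto

lemma rot_closed: "i \<in> {1..<n} \<Longrightarrow> rot i \<in> carrier Aut"
  using reflection_closed by (auto simp: rot_def)

lemma rot_flag: "i \<in> {1..<n} \<Longrightarrow> rot i ` \<Phi> = adj i (adj (i - 1) \<Phi>)"
  unfolding rot_def by (rule reflection_mult_flag) auto

lemma Wplus_images_rot: "Wplus_images n Aut rot"
  using rot_closed rot_flag by (intro Wplus_images_rotations[OF base]) blast+

text \<open>Checked on generators, with r_i for the reflections: r0 (r0 r1) r0 = r1 r0 is the
  inverse of the first rotation; r0 r1 r0 r1 r1 r2 = r0 (r1 r2) r0, since r0 and r2 commute; for
  \<open>i \<ge> 3\<close>, r0 commutes with both factors of \<open>rot i\<close>.\<close>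

lemma pres_hom_conj_aut:
  assumes n: "0 < n" and w: "w \<in> carrier (Wplus n)"
  shows "pres_hom Aut rot (conj_aut n w) = \<rho> 0 \<otimes>\<^bsub>Aut\<^esub> pres_hom Aut rot w \<otimes>\<^bsub>Aut\<^esub> \<rho> 0"
proof -
  interpret h: group_hom "Wplus n" Aut "pres_hom Aut rot"
    by (rule group_hom_pres_hom[OF group_Aut Wplus_images_rot])
  have r: "\<rho> 0 \<in> carrier Aut" "\<rho> 0 \<otimes>\<^bsub>Aut\<^esub> \<rho> 0 = \<one>\<^bsub>Aut\<^esub>"
    using reflection_closed reflection_square n by auto
  have cancel: "\<rho> i \<otimes>\<^bsub>Aut\<^esub> (\<rho> i \<otimes>\<^bsub>Aut\<^esub> x) = x" if "i < n" "x \<in> carrier Aut" for i x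
    using that reflection_closed reflection_square Aut.m_assoc[of "\<rho> i" "\<rho> i" x] by simp
  let ?h = "pres_hom Aut rot" and ?c = "\<lambda>x. \<rho> 0 \<otimes>\<^bsub>Aut\<^esub> x \<otimes>\<^bsub>Aut\<^esub> \<rho> 0"
  have c: "?c \<in> hom Aut Aut"
    using r cancel n by (intro homI) (simp_all add: Aut.m_assoc)
  have "(?h \<circ> conj_aut n) w = (?c \<circ> ?h) w"
  proof (rule Wplus_hom_eqI[OF group_Aut _ _ _ w])
    show "?h \<circ> conj_aut n \<in> hom (Wplus n) Aut"
      by (rule hom_compose[OF conj_aut_hom h.homh])
    show "?c \<circ> ?h \<in> hom (Wplus n) Aut"
      by (rule hom_compose[OF h.homh c])
    fix i assume i: "i \<in> {1..<n}"
    have hg: "?h (Wplus_gen n j) = rot j" if "j \<in> {1..<n}" for j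
      by (rule pres_hom_Wplus_gen[OF group_Aut Wplus_images_rot that])
    have g: "Wplus_gen n j \<in> carrier (Wplus n)" if "j \<in> {1..<n}" for j
      by (rule Wplus_gen_closed[OF that])
    have r1: "\<rho> 1 \<in> carrier Aut" if "1 < n" using that by (rule reflection_closed)
    have rot1: "rot 1 = \<rho> 0 \<otimes>\<^bsub>Aut\<^esub> \<rho> 1" and rot2: "rot 2 = \<rho> 1 \<otimes>\<^bsub>Aut\<^esub> \<rho> 2"
      by (simp_all add: rot_def)
    consider "i = 1" | "i = 2" | "3 \<le> i" using i by force
    then show "(?h \<circ> conj_aut n) (Wplus_gen n i) = (?c \<circ> ?h) (Wplus_gen n i)"
    proof cases
      case 1
      have n1: "1 < n" using i 1 by simp
      have "(?h \<circ> conj_aut n) (Wplus_gen n i) = inv\<^bsub>Aut\<^esub> rot 1"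
        using conj_aut_gen[OF i] hg[OF i] g[OF i] 1 h.hom_inv by (simp add: conj_gen_def)
      also have "\<dots> = \<rho> 1 \<otimes>\<^bsub>Aut\<^esub> \<rho> 0"
        unfolding rot1
        by (rule Aut.inv_equality) (use r r1[OF n1] n1 cancel n reflection_square[of 1] in \<open>simp_all add: Aut.m_assoc\<close>)
      finally show ?thesis using hg[OF i] 1 r r1[OF n1] cancel n rot1 by (simp add: Aut.m_assoc)
    next
      case 2
      have n2: "2 < n" "1 < n" using i 2 by auto
      have r2: "\<rho> 2 \<in> carrier Aut" by (rule reflection_closed[OF n2(1)])
      have "conj_aut n (Wplus_gen n 2) = Wplus_gen n 1 \<otimes>\<^bsub>Wplus n\<^esub> Wplus_gen n 1 \<otimes>\<^bsub>Wplus n\<^esub> Wplus_gen n 2"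
        using conj_aut_gen[OF i] 2 g[of 1] n2 by (simp add: conj_gen_def numeral_2_eq_2)
      then have "(?h \<circ> conj_aut n) (Wplus_gen n i) = rot 1 \<otimes>\<^bsub>Aut\<^esub> rot 1 \<otimes>\<^bsub>Aut\<^esub> rot 2"
        using 2 g[of 1] g[of 2] hg[of 1] hg[of 2] n2 by simp
      also have "\<dots> = \<rho> 0 \<otimes>\<^bsub>Aut\<^esub> \<rho> 1 \<otimes>\<^bsub>Aut\<^esub> (\<rho> 0 \<otimes>\<^bsub>Aut\<^esub> \<rho> 2)"
        using r r1[OF n2(2)] r2 n2 cancel unfolding rot1 rot2 by (simp add: Aut.m_assoc)
      also have "\<dots> = \<rho> 0 \<otimes>\<^bsub>Aut\<^esub> \<rho> 1 \<otimes>\<^bsub>Aut\<^esub> (\<rho> 2 \<otimes>\<^bsub>Aut\<^esub> \<rho> 0)"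
        using reflection_commute[of 0 2] n2 by simp
      also have "\<dots> = (?c \<circ> ?h) (Wplus_gen n i)"
        using hg[OF i] 2 r r1[OF n2(2)] r2 rot2 by (simp add: Aut.m_assoc)
      finally show ?thesis .
    next
      case 3
      have ri: "\<rho> (i - 1) \<in> carrier Aut" "\<rho> i \<in> carrier Aut" using i reflection_closed by auto
      have "\<rho> 0 \<otimes>\<^bsub>Aut\<^esub> (\<rho> (i - 1) \<otimes>\<^bsub>Aut\<^esub> \<rho> i) = \<rho> (i - 1) \<otimes>\<^bsub>Aut\<^esub> (\<rho> 0 \<otimes>\<^bsub>Aut\<^esub> \<rho> i)"
        using reflection_commute[of 0 "i - 1"] i 3 r ri by (simp add: Aut.m_assoc[symmetric])
      also have "\<dots> = \<rho> (i - 1) \<otimes>\<^bsub>Aut\<^esub> \<rho> i \<otimes>\<^bsub>Aut\<^esub> \<rho> 0"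
        using reflection_commute[of 0 i] i 3 r ri by (simp add: Aut.m_assoc)
      finally have "?c (rot i) = rot i" using r ri cancel n by (simp add: Aut.m_assoc rot_def)
      then show ?thesis using conj_aut_gen[OF i] hg[OF i] 3 by (simp add: conj_gen_def)
    qed
  qed
  then show ?thesis by simp
qed

lemma conj_aut_rel_subgroup:
  assumes "0 < n" "w \<in> rel_subgroup n (regular_rotation_group n P \<Phi>)"
  shows "conj_aut n w \<in> rel_subgroup n (regular_rotation_group n P \<Phi>)"
  using assms reflection_closed[of 0] reflection_square[of 0]
  by (simp add: regular_rotation_group_eq rel_subgroup_generated_rotary[OF group_Aut Wplus_images_rot]
      kernel_def conj_aut_closed pres_hom_conj_aut)

text \<open>In an abelian simple group the involution \<open>\<sigma>\<^sub>1 \<sigma>\<^sub>2\<close> would be the only non-trivial element,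
  but \<open>\<sigma>\<^sub>1\<close> differs from both \<open>1\<close> and \<open>\<sigma>\<^sub>1 \<sigma>\<^sub>2\<close>.\<close>
lemma simple_rotation_group_nonabelian:
  fixes G defines "G \<equiv> regular_rotation_group n P \<Phi>"
  assumes n: "2 < n" and simple: "simple_group G"
  shows "\<exists>x \<in> carrier G. \<exists>y \<in> carrier G. x \<otimes>\<^bsub>G\<^esub> y \<noteq> y \<otimes>\<^bsub>G\<^esub> x"
proof (rule ccontr)
  interpret G: simple_group G by fact
  assume "\<not> ?thesis"
  then have comm: "x \<otimes>\<^bsub>G\<^esub> y = y \<otimes>\<^bsub>G\<^esub> x" if "x \<in> carrier G" "y \<in> carrier G" for x y
    using that by blast
  interpret G: comm_group G by (rule G.group_comm_groupI) (rule comm)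
  have mult: "x \<otimes>\<^bsub>G\<^esub> y = x \<otimes>\<^bsub>Aut\<^esub> y" and one: "\<one>\<^bsub>G\<^esub> = \<one>\<^bsub>Aut\<^esub>" for x y
    by (simp_all add: G_def regular_rotation_group_eq)
  have rotG: "rot i \<in> carrier G" if "i \<in> {1..<n}" for i
    using that by (auto simp: G_def regular_rotation_group_eq intro: generate.incl)
  let ?t = "rot 1 \<otimes>\<^bsub>G\<^esub> rot 2"
  have t: "?t \<in> carrier G" using rotG[of 1] rotG[of 2] n by (intro G.m_closed) auto
  have r: "\<rho> 0 \<in> carrier Aut" "\<rho> 1 \<in> carrier Aut" "\<rho> 2 \<in> carrier Aut"
    using reflection_closed n by auto
  have t_eq: "?t = \<rho> 0 \<otimes>\<^bsub>Aut\<^esub> \<rho> 2"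
  proof -
    have "\<rho> 1 \<otimes>\<^bsub>Aut\<^esub> (\<rho> 1 \<otimes>\<^bsub>Aut\<^esub> \<rho> 2) = \<rho> 2"
      using r reflection_square[of 1] n by (simp add: Aut.m_assoc[symmetric])
    then show ?thesis using r by (simp add: mult Aut.m_assoc rot_def)
  qed
  have t_flag: "?t ` \<Phi> = adj 2 (adj 0 \<Phi>)"
    unfolding t_eq using reflection_mult_flag[of 0 2] n by simp
  have fl: "adj 0 \<Phi> \<in> flags P" using adj_flag base n by simp
  have one_flag: "\<one>\<^bsub>Aut\<^esub> ` \<Phi> = \<Phi>" by (rule Aut_image_one[OF flag_faces[OF base]])
  \<comment> \<open>Equality would make the \<open>0\<close>-adjacent and the
    \<open>j\<close>-adjacent flags of the base flag coincide.\<close>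
  have adj_ne: "adj j (adj 0 \<Phi>) \<noteq> \<Phi>" if "j < n" "j \<noteq> 0" for j
    using adj_distinct[OF base, of 0 j] adj_adj[OF fl that(1)] that n by auto
  have rot1: "rot 1 ` \<Phi> = adj 1 (adj 0 \<Phi>)" using rot_flag[of 1] n by simp
  have ne: "x \<noteq> \<one>\<^bsub>G\<^esub>" if "x ` \<Phi> = adj j (adj 0 \<Phi>)" "j < n" "j \<noteq> 0" for x j
    using adj_ne[OF that(2,3)] that(1) one_flag by (auto simp: one)
  have "?t \<otimes>\<^bsub>G\<^esub> ?t = (\<rho> 0 \<otimes>\<^bsub>Aut\<^esub> \<rho> 2) \<otimes>\<^bsub>Aut\<^esub> (\<rho> 0 \<otimes>\<^bsub>Aut\<^esub> \<rho> 2)"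
    unfolding t_eq by (rule mult)
  also have "\<dots> = (\<rho> 0 \<otimes>\<^bsub>Aut\<^esub> \<rho> 2) \<otimes>\<^bsub>Aut\<^esub> (\<rho> 2 \<otimes>\<^bsub>Aut\<^esub> \<rho> 0)"
    using reflection_commute[of 0 2] n by simp
  also have "\<dots> = \<rho> 0 \<otimes>\<^bsub>Aut\<^esub> ((\<rho> 2 \<otimes>\<^bsub>Aut\<^esub> \<rho> 2) \<otimes>\<^bsub>Aut\<^esub> \<rho> 0)"
    using r by (simp only: Aut.m_assoc Aut.m_closed)
  also have "\<dots> = \<one>\<^bsub>G\<^esub>" using r reflection_square[of 2] reflection_square[of 0] n by (simp add: one)
  finally have tt: "?t \<otimes>\<^bsub>G\<^esub> ?t = \<one>\<^bsub>G\<^esub>" .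
  have "subgroup {\<one>\<^bsub>G\<^esub>, ?t} G"
  proof (rule G.subgroupI)
    fix a assume "a \<in> {\<one>\<^bsub>G\<^esub>, ?t}"
    then show "inv\<^bsub>G\<^esub> a \<in> {\<one>\<^bsub>G\<^esub>, ?t}" using G.inv_equality[OF tt t t] by auto
    fix b assume "b \<in> {\<one>\<^bsub>G\<^esub>, ?t}"
    then show "a \<otimes>\<^bsub>G\<^esub> b \<in> {\<one>\<^bsub>G\<^esub>, ?t}" using \<open>a \<in> {\<one>\<^bsub>G\<^esub>, ?t}\<close> t tt by auto
  qed (use t in auto)
  \<comment> \<open>Under the assumed commutativity this subgroup is normal, so simplicity makes it
    trivial or everything.\<close>
  then have "{\<one>\<^bsub>G\<^esub>, ?t} = carrier G \<or> {\<one>\<^bsub>G\<^esub>, ?t} = {\<one>\<^bsub>G\<^esub>}"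
    using G.no_real_normal_subgroup G.subgroup_imp_normal by blast
  moreover have "?t \<noteq> \<one>\<^bsub>G\<^esub>" by (rule ne[OF t_flag]) (use n in auto)
  ultimately have "rot 1 \<in> {\<one>\<^bsub>G\<^esub>, ?t}" using rotG[of 1] n by auto
  moreover have "rot 1 \<noteq> \<one>\<^bsub>G\<^esub>" by (rule ne[OF rot1]) (use n in auto)
  moreover have "rot 1 \<noteq> ?t"
  proof
    assume "rot 1 = ?t"
    then have "adj 1 (adj 0 \<Phi>) = adj 2 (adj 0 \<Phi>)" using rot1 t_flag by simp
    then show False using adj_distinct[OF fl, of 1 2] n by simp
  qed
  ultimately show False by blast
qed

end

text \<open>The two chirality groups are quotients by different subgroups of \<open>Wplus n\<close>,
  so their equality is expressed by the natural projection being an isomorphism.\<close>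

theorem theorem4p8:
  fixes n :: nat
    and P :: "'a ranked_poset" and \<Phi> :: "'a set" and \<Gamma>P :: "('a \<Rightarrow> 'a) rotary"
    and Q :: "'b ranked_poset" and \<Psi> :: "'b set" and \<Gamma>Q :: "('b \<Rightarrow> 'b) rotary"
  assumes "chiral_polytope n P" and "finite (faces P)" and "\<Phi> \<in> flags P"
    and "\<Gamma>P = chiral_rotation_group n P \<Phi>"
    and "directly_regular_polytope n Q" and "finite (faces Q)" and "\<Psi> \<in> flags Q"
    and "\<Gamma>Q = regular_rotation_group n Q \<Psi>"
    and "simple_group \<Gamma>Q"
    and "\<not> chirality_group n \<Gamma>P \<cong> \<Gamma>Q"
  shows "natural_projection n \<Gamma>P
           \<in> iso (chirality_group n (mix n \<Gamma>P \<Gamma>Q)) (chirality_group n \<Gamma>P) \<and>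
         chirality_group n (mix n \<Gamma>P \<Gamma>Q) \<cong> chirality_group n \<Gamma>P"
proof -
  interpret P: finite_polytope n P
    using assms(1,2) by unfold_locales (simp_all add: chiral_polytope_def)
  interpret Q: finite_regular_polytope n Q \<Psi>
    using assms(5-7)
    by unfold_locales (simp_all add: directly_regular_polytope_def regular_polytope_def)
  note P_img = P.Wplus_images_chiral_rotation[OF assms(1,3)]
  have GP: "group \<Gamma>P" "Wplus_images n \<Gamma>P (gen \<Gamma>P)"
    using group_generated_rotary[OF P.group_Aut P_img]
      Wplus_images_generated_rotary[OF P.group_Aut P_img]
    by (simp_all add: assms(4) chiral_rotation_group_def)
  have GQ: "Wplus_images n \<Gamma>Q (gen \<Gamma>Q)"
    using Wplus_images_generated_rotary[OF Q.group_Aut Q.Wplus_images_rot]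
    by (simp add: assms(8) Q.regular_rotation_group_eq)
  interpret S: simple_group \<Gamma>Q by fact
  \<comment> \<open>\<open>regular_rotation_group\<close> is generated inside the automorphism
    group. Writing its carrier as an image of \<open>Wplus n\<close> shows that it is generated
    inside itself as well.\<close>
  have gen: "carrier \<Gamma>Q = generate \<Gamma>Q (gen \<Gamma>Q ` {1..<n})"
  proof
    have "carrier \<Gamma>Q = pres_hom (aut_group Q) Q.rot ` carrier (Wplus n)"
      using pres_hom_image[OF Q.group_Aut Q.Wplus_images_rot] by (simp add: assms(8) Q.regular_rotation_group_eq)
    also have "\<dots> = pres_hom \<Gamma>Q (gen \<Gamma>Q) ` carrier (Wplus n)"
      using pres_hom_generated_rotary[OF Q.group_Aut Q.Wplus_images_rot]
      by (simp add: assms(8) Q.regular_rotation_group_eq)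
    also have "\<dots> = generate \<Gamma>Q (gen \<Gamma>Q ` {1..<n})" by (rule pres_hom_image[OF S.is_group GQ])
    finally show "carrier \<Gamma>Q \<subseteq> generate \<Gamma>Q (gen \<Gamma>Q ` {1..<n})" by simp
    show "generate \<Gamma>Q (gen \<Gamma>Q ` {1..<n}) \<subseteq> carrier \<Gamma>Q"
      using S.generate_incl Wplus_images_closed[OF S.is_group GQ] by blast
  qed
  \<comment> \<open>Conjugation by the reflection of index 0 requires positive rank; in rank 0 the
    rotation group would be trivial.\<close>
  have n: "0 < n"
  proof (rule ccontr)
    assume "\<not> 0 < n"
    then show False using gen S.generate_empty S.simple_not_triv by simp
  qed
  have "natural_projection n \<Gamma>P \<in> iso (chirality_group n (mix n \<Gamma>P \<Gamma>Q)) (chirality_group n \<Gamma>P)"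
    using natural_projection_iso[OF GP assms(9) GQ gen] Q.conj_aut_rel_subgroup[OF n]
      Q.simple_rotation_group_nonabelian assms(8,9) by blast
  then show ?thesis by (auto simp: is_iso_def)
qed

end
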